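(* Let $p(\cdot)$ be an irreducible transition probability kernel on $\mathbb{Z}$ with $\sum_x |x|p(x)<\infty$, and suppose that $\sum_x |x|^c p(x)=\infty$ for some $c<2$. Let $(\eta_t)_{t\ge 0}$ be the one-dimensional voter model with kernel $p(\cdot)$ started from the Heaviside configuration $\eta_0$. Then the family $(r_t-l_t)_{t\ge 0}$ is not tight.
   Context: A transition probability kernel $p(\cdot)$ on $\mathbb{Z}$ is irreducible if $\{x: p(x)+p(-x)>0\}$ generates $\mathbb{Z}$. The voter model with kernel $p$ is the spin system on $\{0,1\}^{\mathbb{Z}}$ in which site $x$ flips at rate $c(x,\eta)=\sum_y p(y-x)\mathbf{1}_{\eta(x)\neq\eta(y)}$. The Heaviside configuration is $\eta_0(z)=1$ for $z\le 0$ and $\eta_0(z)=0$ for $z\ge 1$. For $t>0$, $r_t=\sup\{x:\eta_t(x)=1\}$ and $l_t=\inf\{x:\eta_t(x)=0\}$ (a.s. finite under the first moment assumption). *)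

theory Defs
  imports "HOL-Probability.Probability"
begin

inductive_set int_subgroup_gen :: "int set \<Rightarrow> int set" for S :: "int set" where
  gen_zero: "0 \<in> int_subgroup_gen S"
| gen_base: "x \<in> S \<Longrightarrow> x \<in> int_subgroup_gen S"
| gen_diff: "a \<in> int_subgroup_gen S \<Longrightarrow> b \<in> int_subgroup_gen S \<Longrightarrow> a - b \<in> int_subgroup_gen S"

definition irreducible_kernel :: "int pmf \<Rightarrow> bool" where
  "irreducible_kernel p \<longleftrightarrow>
     int_subgroup_gen {x. pmf p x + pmf p (-x) > 0} = UNIV"

text \<open>Randomness: for every site x and index i, an Exp(1) inter-arrival time
  and a displacement mark with law p (all independent).  Site x has a rate-1
  Poisson clock with arrival times arr w x k; at arrival k the site x adopts
  the opinion of site x + mark.  This realises flip rates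
  c(x,eta) = sum_y p(y-x) 1[eta(x) /= eta(y)].\<close>

type_synonym vm_omega = "int \<times> nat \<Rightarrow> real \<times> int"

definition vm_space :: "int pmf \<Rightarrow> vm_omega measure" where
  "vm_space p = (\<Pi>\<^sub>M i\<in>(UNIV :: (int \<times> nat) set).
       density lborel (exponential_density 1) \<Otimes>\<^sub>M measure_pmf p)"

definition arr :: "vm_omega \<Rightarrow> int \<Rightarrow> nat \<Rightarrow> real" where
  "arr w y k = (\<Sum>i\<le>k. fst (w (y, i)))"

definition fstep :: "vm_omega \<Rightarrow> int \<Rightarrow> real \<Rightarrow> int \<times> real" where
  "fstep w x t = (if \<exists>k. arr w x k \<le> t then
       (let k = (GREATEST k. arr w x k \<le> t) in (x + snd (w (x, k)), arr w x k))
     else (x, t))"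

definition bstep :: "vm_omega \<Rightarrow> int \<times> real \<Rightarrow> int \<times> real" where
  "bstep w ys = (let y = fst ys; s = snd ys in
     if \<exists>k. arr w y k < s then
       (let k = (GREATEST k. arr w y k < s) in (y + snd (w (y, k)), arr w y k))
     else (y, s))"

text \<open>Dual (backward) walk endpoint at time 0, from (x,t).  It terminates a.s.;
  otherwise a junk value is returned.\<close>
definition dual :: "vm_omega \<Rightarrow> int \<Rightarrow> real \<Rightarrow> int" where
  "dual w x t = (let z = fstep w x t in
     if \<exists>n. bstep w ((bstep w ^^ n) z) = (bstep w ^^ n) z
     then fst ((bstep w ^^ (LEAST n. bstep w ((bstep w ^^ n) z) = (bstep w ^^ n) z)) z)
     else x)"

text \<open>Heaviside initial configuration (True = opinion 1).\<close>
definition heaviside :: "int \<Rightarrow> bool" where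
  "heaviside z \<longleftrightarrow> z \<le> 0"

definition voter :: "vm_omega \<Rightarrow> real \<Rightarrow> int \<Rightarrow> bool" where
  "voter w t x = heaviside (dual w x t)"

definition rmost :: "vm_omega \<Rightarrow> real \<Rightarrow> int" where
  "rmost w t = Sup {x. voter w t x}"

definition lmost :: "vm_omega \<Rightarrow> real \<Rightarrow> int" where
  "lmost w t = Inf {x. \<not> voter w t x}"

definition tight_family :: "'a measure \<Rightarrow> (real \<Rightarrow> 'a \<Rightarrow> real) \<Rightarrow> bool" where
  "tight_family M X \<longleftrightarrow>
     (\<forall>\<epsilon>>0. \<exists>K. \<forall>t\<ge>0. measure M {w \<in> space M. \<bar>X t w\<bar> > K} \<le> \<epsilon>)"

end

theory Submission
  imports Defs
begin

text \<open>
  If both dual walks started at \<open>x < y\<close> survive without meeting and cross, then \<open>x\<close> carries opinion 0 and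
  \<open>y\<close> carries opinion 1, so the interface is at least \<open>y - x\<close> wide; it is enough to make such a crossing
  likely, uniformly over arbitrarily large \<open>y - x\<close>.

  Let \<open>Q n\<close> be the probability of a jump of size at least \<open>n\<close> and \<open>V n\<close> the second moment of the jumps
  smaller than \<open>n\<close>.  If \<open>n\<^sup>2 Q n / V n\<close> tended to 0, then \<open>V\<close> would grow more slowly than any power along
  dyadic scales and all moments of order below 2 would be finite.  Hence \<open>V n \<le> C n\<^sup>2 Q n\<close> for infinitely
  many \<open>n\<close>.  At such a scale start the walks at distance of order \<open>n\<close> and run them for time
  \<open>\<tau> / Q n\<close> with \<open>\<tau>\<close> small.  The small jumps then move either walk by at most a small multiple of \<open>n\<close>
  around its mean, while with probability of order \<open>\<tau>\<close> exactly one jump of size at least \<open>n\<close> occurs and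
  carries one walk over the other.  Quadratic subsolutions of the two-walk recursion make this
  quantitative without any maximal inequality.

  The first moment enters only through the almost sure finiteness of the two interface ends, without
  which \<open>Sup\<close> and \<open>Inf\<close> on the integers would return junk values.
\<close>

section \<open>The clocks after a fixed time\<close>

text \<open>Every probability is bounded from below only, and this fixes the shape of the proof. The
  graphical construction is read backwards, so enlarging the time from \<open>t\<close> to
  \<open>t + h\<close> adds a new piece at the start of the dual walk, and the clocks restart there
  by memorylessness. Configurations with further rings in that window are simply discarded: this
  costs order \<open>h ^ 2\<close> per step, hence order \<open>t * h\<close> in total, and a fine
  mesh makes it harmless. The recursions obtained this way are inequalities, and what follows them
  is a deterministic comparison argument.

  The obstacle is coalescence. Two walks that meet stay together, so a comparison function for the
  pair must be nonpositive on the diagonal. Truncated paraboloids over discs away from the diagonal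
  have this property, and averaging them over the small jumps involves only two moments. The
  crossing itself is made by one big jump that passes over the diagonal, so two discs occur: one
  with the first walk to the left, before the jump, and one with it to the right, after the
  jump.\<close>

definition mark_space :: "int pmf \<Rightarrow> (real \<times> int) measure" where
  "mark_space p = density lborel (exponential_density 1) \<Otimes>\<^sub>M measure_pmf p"

definition presum :: "vm_omega \<Rightarrow> int \<Rightarrow> nat \<Rightarrow> real" where
  "presum w y k = (\<Sum>i<k. fst (w (y, i)))"

text \<open>The space contains a null set of configurations with zero or negative gaps, on which
  \<open>arr\<close> need not be monotone. Pathwise statements are restricted to the
  complement.\<close>

definition pos_gaps :: "vm_omega \<Rightarrow> bool" where
  "pos_gaps w \<longleftrightarrow> (\<forall>i. 0 < fst (w i))"

text \<open>The first arrival at \<open>y\<close> after time \<open>t\<close> has residual waiting time and mark in \<open>B\<close>, and the next gap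
  exceeds \<open>d\<close>.\<close>

definition fut :: "vm_omega \<Rightarrow> int \<Rightarrow> real \<Rightarrow> (real \<times> int) set \<Rightarrow> real \<Rightarrow> bool" where
  "fut w y t B d \<longleftrightarrow> (\<exists>k. presum w y k \<le> t \<and> t < presum w y (Suc k) \<and>
     (presum w y (Suc k) - t, snd (w (y, k))) \<in> B \<and> d < fst (w (y, Suc k)))"

text \<open>At the site \<open>y\<close>, the event \<open>W\<close> is allowed to depend only on the arrivals up to time \<open>t\<close>; its dependence on
  the other sites is unrestricted.\<close>

definition past_det :: "int \<Rightarrow> real \<Rightarrow> (vm_omega \<Rightarrow> bool) \<Rightarrow> bool" where
  "past_det y t W \<longleftrightarrow> (\<forall>w w' k. pos_gaps w \<longrightarrow> pos_gaps w' \<longrightarrow>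
     (\<forall>i. fst i \<noteq> y \<or> snd i < k \<longrightarrow> w i = w' i) \<longrightarrow> presum w y k \<le> t \<longrightarrow>
     t < presum w y (Suc k) \<longrightarrow> t < presum w' y (Suc k) \<longrightarrow> W w \<longrightarrow> W w')"

section \<open>The product space and integration over a single coordinate\<close>

lemma vm_space_alt: "vm_space p = (\<Pi>\<^sub>M i\<in>UNIV. mark_space p)"
  by (simp add: vm_space_def mark_space_def)

lemma prob_space_mark: "prob_space (mark_space p)"
proof -
  interpret E: prob_space "density lborel (exponential_density 1)"
    by (rule prob_space_exponential_density) simp
  interpret P: pair_prob_space "density lborel (exponential_density 1)" "measure_pmf p" ..
  show ?thesis unfolding mark_space_def by (rule P.prob_space_axioms)
qed

lemma prob_space_vm: "prob_space (vm_space p)"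
  unfolding vm_space_alt by (intro prob_space_PiM prob_space_mark)

lemma sets_mark[measurable_cong]: "sets (mark_space p) = sets (borel \<Otimes>\<^sub>M count_space UNIV)"
  unfolding mark_space_def by (intro sets_pair_measure_cong) auto

lemma space_mark[simp]: "space (mark_space p) = UNIV"
  by (simp add: mark_space_def space_pair_measure)

lemma space_vm[simp]: "space (vm_space p) = UNIV"
  by (simp add: vm_space_alt space_PiM)

lemma measurable_coord[measurable]: "(\<lambda>w. w i) \<in> vm_space p \<rightarrow>\<^sub>M borel \<Otimes>\<^sub>M count_space UNIV"
proof -
  have "(\<lambda>w. w i) \<in> vm_space p \<rightarrow>\<^sub>M mark_space p"
    unfolding vm_space_alt by (rule measurable_component_singleton) simp
  then show ?thesis by (simp cong: measurable_cong_sets add: sets_mark)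
qed

lemma measurable_fst_coord[measurable]: "(\<lambda>w. fst (w i)) \<in> borel_measurable (vm_space p)"
  by measurable
lemma measurable_snd_coord[measurable]: "(\<lambda>w. snd (w i)) \<in> vm_space p \<rightarrow>\<^sub>M count_space UNIV"
  by measurable

lemma measurable_presum[measurable]: "(\<lambda>w. presum w y k) \<in> borel_measurable (vm_space p)"
  unfolding presum_def by measurable

lemma measurable_pos_gaps[measurable]: "Measurable.pred (vm_space p) pos_gaps"
  unfolding pos_gaps_def by measurable

lemma measurable_residual[measurable]:
  assumes B[measurable]: "B \<in> sets (borel \<Otimes>\<^sub>M count_space UNIV)"
  shows "Measurable.pred (vm_space p) (\<lambda>w. (presum w y (Suc k) - t, snd (w (y, k))) \<in> B)"
proof (rule measurable_compose[where g="\<lambda>v. v \<in> B" and N="borel \<Otimes>\<^sub>M count_space UNIV"])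
  show "(\<lambda>w. (presum w y (Suc k) - t, snd (w (y, k)))) \<in> vm_space p \<rightarrow>\<^sub>M borel \<Otimes>\<^sub>M count_space UNIV"
    by (intro measurable_Pair) simp_all
qed measurable

lemma measurable_fut[measurable]:
  assumes [measurable]: "B \<in> sets (borel \<Otimes>\<^sub>M count_space UNIV)"
  shows "Measurable.pred (vm_space p) (\<lambda>w. fut w y t B d)"
  unfolding fut_def by measurable

text \<open>Overwriting coordinate \<open>i\<close> by an independent mark leaves the product law
  unchanged, so Fubini integrates one coordinate while all the others are frozen. This takes the
  place of conditional probabilities.\<close>

lemma emeasure_vm_split:
  assumes A: "A \<in> sets (vm_space p)"
  shows "emeasure (vm_space p) A =
    (\<integral>\<^sup>+X. emeasure (mark_space p) {v. X(i := v) \<in> A} \<partial>vm_space p)"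
proof -
  interpret M: prob_space "mark_space p" by (rule prob_space_mark)
  interpret V: prob_space "vm_space p" by (rule prob_space_vm)
  interpret P: pair_prob_space "mark_space p" "vm_space p" ..
  have eq: "distr (mark_space p \<Otimes>\<^sub>M vm_space p) (vm_space p) (\<lambda>(x, X). X(i := x)) = vm_space p"
    using distr_pair_PiM_eq_PiM[of UNIV "\<lambda>_. mark_space p" i] prob_space_mark
    by (simp add: vm_space_alt)
  have [measurable]: "(\<lambda>(x, X). X(i := x)) \<in> mark_space p \<Otimes>\<^sub>M vm_space p \<rightarrow>\<^sub>M vm_space p"
    unfolding vm_space_alt split_beta' by (rule measurable_fun_upd[where J=UNIV]) auto
  have "emeasure (vm_space p) A = emeasure (distr (mark_space p \<Otimes>\<^sub>M vm_space p) (vm_space p) (\<lambda>(x, X). X(i := x))) A"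
    by (simp add: eq)
  also have "\<dots> = emeasure (mark_space p \<Otimes>\<^sub>M vm_space p) ((\<lambda>(x, X). X(i := x)) -` A \<inter> space (mark_space p \<Otimes>\<^sub>M vm_space p))"
    by (rule emeasure_distr) (use A in measurable)
  also have "\<dots> = (\<integral>\<^sup>+X. emeasure (mark_space p) ((\<lambda>x. (x, X)) -` ((\<lambda>(x, X). X(i := x)) -` A \<inter> space (mark_space p \<Otimes>\<^sub>M vm_space p))) \<partial>vm_space p)"
    by (rule P.emeasure_pair_measure_alt2) (use A in measurable)
  also have "\<dots> = (\<integral>\<^sup>+X. emeasure (mark_space p) {v. X(i := v) \<in> A} \<partial>vm_space p)"
    by (simp add: vimage_def space_pair_measure)
  finally show ?thesis .
qed

lemma measurable_upd[measurable]: "(\<lambda>v. X(i := v)) \<in> mark_space p \<rightarrow>\<^sub>M vm_space p"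
  unfolding vm_space_alt
  by (rule measurable_fun_upd[where J=UNIV]) (auto simp: space_PiM)

text \<open>A ratio that is the same on every fibre of coordinate \<open>i\<close> survives
  integration over the remaining coordinates.\<close>

lemma emeasure_vm_scale:
  assumes A[measurable]: "A \<in> sets (vm_space p)" and A'[measurable]: "A' \<in> sets (vm_space p)"
  assumes "\<And>X. emeasure (mark_space p) {v. X(i := v) \<in> A'} = c * emeasure (mark_space p) {v. X(i := v) \<in> A}"
  shows "emeasure (vm_space p) A' = c * emeasure (vm_space p) A"
proof -
  interpret M: prob_space "mark_space p" by (rule prob_space_mark)
  have [measurable]: "(\<lambda>X. emeasure (mark_space p) {v. X(i := v) \<in> A}) \<in> borel_measurable (vm_space p)"
  proof -
    have [measurable]: "(\<lambda>(X, x). X(i := x)) \<in> vm_space p \<Otimes>\<^sub>M mark_space p \<rightarrow>\<^sub>M vm_space p"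
      unfolding vm_space_alt split_beta' by (rule measurable_fun_upd[where J=UNIV]) auto
    have "{v \<in> space (vm_space p \<Otimes>\<^sub>M mark_space p). (case v of (X, x) \<Rightarrow> X(i := x)) \<in> A} \<in> sets (vm_space p \<Otimes>\<^sub>M mark_space p)"
      by measurable
    from M.measurable_emeasure_Pair[OF this] show ?thesis
      by (simp add: vimage_def space_pair_measure)
  qed
  show ?thesis
    unfolding emeasure_vm_split[OF A, of i] emeasure_vm_split[OF A', of i] assms(3)
    by (rule nn_integral_cmult) measurable
qed

text \<open>Memorylessness of the exponential law: translation by \<open>r\<close> multiplies its
  density by \<open>exp (- r)\<close>. Positivity of \<open>B\<close> matters because between
  \<open>- r\<close> and 0 the translated density is positive, so the indicator of \<open>B\<close>
  has to vanish there.\<close>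

lemma emeasure_mark_shift:
  assumes B[measurable]: "B \<in> sets (borel \<Otimes>\<^sub>M count_space UNIV)" and Bpos: "\<And>e m. (e, m) \<in> B \<Longrightarrow> 0 < e"
    and r: "0 \<le> r"
  shows "emeasure (mark_space p) {(e, m). (e - r, m) \<in> B} = exp (- r) * emeasure (mark_space p) B"
proof -
  interpret E: prob_space "density lborel (exponential_density 1)"
    by (rule prob_space_exponential_density) simp
  interpret P: pair_prob_space "density lborel (exponential_density 1)" "measure_pmf p" ..
  have S: "{(e, m). (e - r, m) \<in> B} \<in> sets (mark_space p)"
  proof -
    have "{v \<in> space (borel \<Otimes>\<^sub>M count_space UNIV). (fst v - r, snd v) \<in> B} \<in> sets (borel \<Otimes>\<^sub>M count_space UNIV)"
      by measurable
    then show ?thesis by (simp add: sets_mark space_pair_measure split_beta')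
  qed
  have eqn: "emeasure (density lborel (exponential_density 1)) {e. (e - r, m) \<in> B} =
    exp (- r) * emeasure (density lborel (exponential_density 1)) {e. (e, m) \<in> B}" for m
  proof -
    have I[measurable]: "{e. (e, m) \<in> B} \<in> sets borel"
    proof -
      have "{e \<in> space borel. (e, m) \<in> B} \<in> sets borel" by measurable
      then show ?thesis by simp
    qed
    have I': "{e. (e - r, m) \<in> B} \<in> sets borel"
    proof -
      have "{e \<in> space borel. (e - r, m) \<in> B} \<in> sets borel" by measurable
      then show ?thesis by simp
    qed
    have "emeasure (density lborel (exponential_density 1)) {e. (e - r, m) \<in> B} =
       (\<integral>\<^sup>+e. ennreal (exponential_density 1 e) * indicator {e. (e - r, m) \<in> B} e \<partial>lborel)"
      using I' by (subst emeasure_density) (auto simp: ennreal_mult' ennreal_indicator)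
    also have "\<dots> = (\<integral>\<^sup>+e. ennreal (exponential_density 1 (r + 1 * e)) * indicator {e. (e - r, m) \<in> B} (r + 1 * e) \<partial>lborel)"
      using I' by (subst nn_integral_real_affine[where c=1 and t=r]) auto
    also have "\<dots> = (\<integral>\<^sup>+e. ennreal (exp (- r)) * (ennreal (exponential_density 1 e) * indicator {e. (e, m) \<in> B} e) \<partial>lborel)"
    proof (rule nn_integral_cong)
      fix e :: real
      show "ennreal (exponential_density 1 (r + 1 * e)) * indicator {e. (e - r, m) \<in> B} (r + 1 * e) =
          ennreal (exp (- r)) * (ennreal (exponential_density 1 e) * indicator {e. (e, m) \<in> B} e)"
        using Bpos[of e m] r
        by (auto simp: indicator_def exponential_density_def ennreal_mult[symmetric] exp_add[symmetric])
    qed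
    also have "\<dots> = exp (- r) * (\<integral>\<^sup>+e. ennreal (exponential_density 1 e) * indicator {e. (e, m) \<in> B} e \<partial>lborel)"
      using I by (intro nn_integral_cmult) auto
    also have "\<dots> = exp (- r) * emeasure (density lborel (exponential_density 1)) {e. (e, m) \<in> B}"
      using I by (subst emeasure_density) auto
    finally show ?thesis .
  qed
  have "emeasure (mark_space p) {(e, m). (e - r, m) \<in> B} =
      (\<integral>\<^sup>+m. emeasure (density lborel (exponential_density 1)) {e. (e - r, m) \<in> B} \<partial>measure_pmf p)"
    using S unfolding mark_space_def by (subst P.emeasure_pair_measure_alt2) (auto simp: vimage_def)
  also have "\<dots> = (\<integral>\<^sup>+m. exp (- r) * emeasure (density lborel (exponential_density 1)) {e. (e, m) \<in> B} \<partial>measure_pmf p)"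
    by (simp add: eqn)
  also have "\<dots> = exp (- r) * (\<integral>\<^sup>+m. emeasure (density lborel (exponential_density 1)) {e. (e, m) \<in> B} \<partial>measure_pmf p)"
    by (rule nn_integral_cmult) auto
  also have "(\<integral>\<^sup>+m. emeasure (density lborel (exponential_density 1)) {e. (e, m) \<in> B} \<partial>measure_pmf p) = emeasure (mark_space p) B"
    using B unfolding mark_space_def sets_mark[symmetric]
    by (subst P.emeasure_pair_measure_alt2) (auto simp: vimage_def sets_mark[unfolded mark_space_def])
  finally show ?thesis .
qed

section \<open>Exponential gaps and the growth of the arrival times\<close>

lemma emeasure_mark_Times:
  assumes "I \<in> sets borel"
  shows "emeasure (mark_space p) (I \<times> C) = emeasure (density lborel (exponential_density 1)) I * emeasure (measure_pmf p) C"
  unfolding mark_space_def using assms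
  by (subst measure_pmf.emeasure_pair_measure_Times) auto

lemma emeasure_exp_gt:
  assumes "0 \<le> d"
  shows "emeasure (density lborel (exponential_density 1)) {d<..} = exp (- d)"
proof -
  interpret E: prob_space "density lborel (exponential_density 1)"
    by (rule prob_space_exponential_density) simp
  have "distributed (density lborel (exponential_density 1)) lborel (\<lambda>x. x) (exponential_density 1)"
    unfolding distributed_def by (auto simp: distr_id2)
  from E.exponential_distributedD_gt[OF this assms] show ?thesis
    by (simp add: E.emeasure_eq_measure greaterThan_def)
qed

lemma emeasure_exp_pos: "emeasure (density lborel (exponential_density 1)) {0<..} = 1"
  using emeasure_exp_gt[of 0] by simp

lemma emeasure_exp_Ioc:
  assumes "0 \<le> d"
  shows "emeasure (density lborel (exponential_density 1)) {0<..d} = ennreal (1 - exp (- d))"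
proof -
  interpret E: prob_space "density lborel (exponential_density 1)"
    by (rule prob_space_exponential_density) simp
  have "{0<..d} = {0<..} - {d<..}" by auto
  also have "emeasure (density lborel (exponential_density 1)) \<dots> = 1 - exp (- d)"
    using assms by (subst emeasure_Diff) (auto simp: emeasure_exp_gt emeasure_exp_pos ennreal_minus ennreal_1[symmetric] simp del: ennreal_1)
  finally show ?thesis .
qed

lemma AE_pos_gaps: "AE w in vm_space p. pos_gaps w"
  unfolding pos_gaps_def
proof (subst AE_all_countable, intro allI)
  fix i
  have "AE v in mark_space p. 0 < fst v"
  proof -
    interpret prob_space "mark_space p" by (rule prob_space_mark)
    have "measure (mark_space p) ({0<..} \<times> UNIV) = 1"
      using emeasure_mark_Times[of "{0<..}" p UNIV] by (simp add: emeasure_exp_pos measure_def)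
    then have "AE v in mark_space p. v \<in> {0<..} \<times> UNIV" by (rule AE_prob_1)
    then show ?thesis by eventually_elim auto
  qed
  then show "AE w in vm_space p. 0 < fst (w i)"
    unfolding vm_space_alt by (intro AE_PiM_component prob_space_mark) auto
qed

lemma pos_upd: "pos_gaps (w(i := v)) \<longleftrightarrow> 0 < fst v \<and> (\<forall>j. j \<noteq> i \<longrightarrow> 0 < fst (w j))"
  unfolding pos_gaps_def by (metis fun_upd_apply)

text \<open>By \<open>ins\<close>, the event \<open>F\<close> ignores coordinate \<open>i\<close>
  among configurations with positive gaps, hence is independent of the gap there.\<close>

lemma emeasure_coord_gt:
  assumes [measurable]: "Measurable.pred (vm_space p) F" and d: "0 \<le> d"
    and ins: "\<And>w v v'. pos_gaps (w(i := v)) \<Longrightarrow> pos_gaps (w(i := v')) \<Longrightarrow> F (w(i := v)) \<Longrightarrow> F (w(i := v'))"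
  shows "emeasure (vm_space p) {w. F w \<and> pos_gaps w \<and> d < fst (w i)} = exp (- d) * emeasure (vm_space p) {w. F w \<and> pos_gaps w}"
proof (rule emeasure_vm_scale[where i=i])
  have "{w \<in> space (vm_space p). F w \<and> pos_gaps w} \<in> sets (vm_space p)" by measurable
  then show "{w. F w \<and> pos_gaps w} \<in> sets (vm_space p)" by simp
  have "{w \<in> space (vm_space p). F w \<and> pos_gaps w \<and> d < fst (w i)} \<in> sets (vm_space p)" by measurable
  then show "{w. F w \<and> pos_gaps w \<and> d < fst (w i)} \<in> sets (vm_space p)" by simp
  fix X
  \<comment> \<open>\<open>(1, 0)\<close> is an arbitrary mark with positive gap; by
    \<open>ins\<close> it decides \<open>F\<close> on the whole fibre.\<close>
  define c where "c \<longleftrightarrow> F (X(i := (1, 0))) \<and> (\<forall>j. j \<noteq> i \<longrightarrow> 0 < fst (X j))"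
  have e: "F (X(i := v)) \<and> pos_gaps (X(i := v)) \<longleftrightarrow> c \<and> 0 < fst v" for v
    using ins[of X v "(1,0)"] ins[of X "(1,0)" v] unfolding c_def pos_upd by auto
  have 1: "{v. X(i := v) \<in> {w. F w \<and> pos_gaps w \<and> d < fst (w i)}} = (if c then {d<..} \<times> UNIV else {})"
  proof -
    have "X(i := v) \<in> {w. F w \<and> pos_gaps w \<and> d < fst (w i)} \<longleftrightarrow> c \<and> d < fst v" for v
      using e[of v] d by auto
    then show ?thesis by auto
  qed
  have 2: "{v. X(i := v) \<in> {w. F w \<and> pos_gaps w}} = (if c then {0<..} \<times> UNIV else {})"
    using e by auto
  show "emeasure (mark_space p) {v. X(i := v) \<in> {w. F w \<and> pos_gaps w \<and> d < fst (w i)}} =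
     exp (- d) * emeasure (mark_space p) {v. X(i := v) \<in> {w. F w \<and> pos_gaps w}}"
    unfolding 1 2 using d by (auto simp: emeasure_mark_Times emeasure_exp_gt emeasure_exp_pos)
qed

lemma presum_Suc: "presum w y (Suc k) = presum w y k + fst (w (y, k))"
  by (simp add: presum_def)

lemma presum_mono: "pos_gaps w \<Longrightarrow> j \<le> k \<Longrightarrow> presum w y j \<le> presum w y k"
  unfolding presum_def pos_gaps_def by (intro sum_mono2) (auto intro: less_imp_le)

lemma presum_strict_mono: "pos_gaps w \<Longrightarrow> j < k \<Longrightarrow> presum w y j < presum w y k"
proof -
  assume w: "pos_gaps w" and jk: "j < k"
  have "0 < fst (w (y, j))" using w by (simp add: pos_gaps_def)
  moreover have "presum w y (Suc j) \<le> presum w y k" using w jk by (intro presum_mono) auto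
  ultimately show ?thesis by (simp add: presum_Suc)
qed

lemma presum_cong: "(\<And>j. j < k \<Longrightarrow> w (y, j) = w' (y, j)) \<Longrightarrow> presum w y k = presum w' y k"
  by (simp add: presum_def)

lemma presum_upd[simp]: "presum (w((y, k) := v)) y k = presum w y k"
  by (intro presum_cong) auto

lemma presum_upd_Suc[simp]: "presum (w((y, k) := v)) y (Suc k) = presum w y k + fst v"
  by (simp add: presum_Suc)

text \<open>If the partial sums stay at most \<open>t'\<close>, no gap exceeds \<open>t'\<close>.
  Each gap does so with probability \<open>exp (- t')\<close> independently of the earlier ones, so
  the probability that \<open>k\<close> gaps fit below \<open>t'\<close> decays geometrically in
  \<open>k\<close>.\<close>

lemma AE_presum_unbounded: "AE w in vm_space p. \<exists>k. t < presum w y k"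
proof -
  interpret V: prob_space "vm_space p" by (rule prob_space_vm)
  define t' where "t' = max t 0"
  define a where "a k = measure (vm_space p) {w. presum w y k \<le> t' \<and> pos_gaps w}" for k
  have [measurable]: "{w. presum w y k \<le> t' \<and> pos_gaps w} \<in> sets (vm_space p)" for k
  proof -
    have "{w \<in> space (vm_space p). presum w y k \<le> t' \<and> pos_gaps w} \<in> sets (vm_space p)" by measurable
    then show ?thesis by simp
  qed
  have [measurable]: "{w. presum w y k \<le> t' \<and> pos_gaps w \<and> t' < fst (w (y, k))} \<in> sets (vm_space p)" for k
  proof -
    have "{w \<in> space (vm_space p). presum w y k \<le> t' \<and> pos_gaps w \<and> t' < fst (w (y, k))} \<in> sets (vm_space p)" by measurable
    then show ?thesis by simp
  qed
  have step: "a (Suc k) \<le> (1 - exp (- t')) * a k" for k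
  proof -
    have "emeasure (vm_space p) {w. presum w y k \<le> t' \<and> pos_gaps w \<and> t' < fst (w (y, k))} =
        exp (- t') * emeasure (vm_space p) {w. presum w y k \<le> t' \<and> pos_gaps w}"
      by (rule emeasure_coord_gt) (auto simp: t'_def)
    then have 1: "measure (vm_space p) {w. presum w y k \<le> t' \<and> pos_gaps w \<and> t' < fst (w (y, k))} = exp (- t') * a k"
      unfolding a_def V.emeasure_eq_measure by (simp add: ennreal_mult'[symmetric])
    have "a (Suc k) \<le> measure (vm_space p) ({w. presum w y k \<le> t' \<and> pos_gaps w} - {w. presum w y k \<le> t' \<and> pos_gaps w \<and> t' < fst (w (y, k))})"
      unfolding a_def
    proof (rule V.finite_measure_mono)
      show "{w. presum w y (Suc k) \<le> t' \<and> pos_gaps w}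
         \<subseteq> {w. presum w y k \<le> t' \<and> pos_gaps w} - {w. presum w y k \<le> t' \<and> pos_gaps w \<and> t' < fst (w (y, k))}"
      proof safe
        fix w assume w: "presum w y (Suc k) \<le> t'" "pos_gaps w"
        show "presum w y k \<le> t'" using presum_mono[OF w(2), of k "Suc k" y] w(1) by simp
        assume "t' < fst (w (y, k))"
        moreover have "0 \<le> presum w y k" using presum_mono[OF w(2), of 0 k y] by (simp add: presum_def)
        ultimately show False using w(1) by (simp add: presum_Suc)
      qed
    qed measurable
    also have "\<dots> = a k - exp (- t') * a k"
      unfolding a_def 1[symmetric, unfolded a_def] by (rule V.finite_measure_Diff) auto
    finally show ?thesis by (simp add: algebra_simps)
  qed
  have ak: "a k \<le> (1 - exp (- t')) ^ k" for k
  proof (induction k)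
    case 0 then show ?case by (simp add: a_def)
  next
    case (Suc k)
    have "a (Suc k) \<le> (1 - exp (- t')) * a k" by (rule step)
    also have "\<dots> \<le> (1 - exp (- t')) * (1 - exp (- t')) ^ k"
      using Suc by (intro mult_left_mono) (auto simp: t'_def)
    finally show ?case by simp
  qed
  define Z where "Z = {w. (\<forall>k. presum w y k \<le> t') \<and> pos_gaps w}"
  have Zs: "Z \<in> sets (vm_space p)"
  proof -
    have "{w \<in> space (vm_space p). (\<forall>k. presum w y k \<le> t') \<and> pos_gaps w} \<in> sets (vm_space p)" by measurable
    then show ?thesis by (simp add: Z_def)
  qed
  have "measure (vm_space p) Z \<le> (1 - exp (- t')) ^ k" for k
  proof -
    have "measure (vm_space p) Z \<le> a k"
      unfolding a_def by (rule V.finite_measure_mono) (auto simp: Z_def)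
    with ak[of k] show ?thesis by linarith
  qed
  moreover have "(\<lambda>k. (1 - exp (- t')) ^ k) \<longlonglongrightarrow> 0"
    by (rule LIMSEQ_realpow_zero) (auto simp: t'_def)
  ultimately have "measure (vm_space p) Z \<le> 0"
    by (intro LIMSEQ_le_const) auto
  then have "measure (vm_space p) Z = 0" by (simp add: measure_le_0_iff)
  then have "emeasure (vm_space p) Z = 0" by (simp add: V.emeasure_eq_measure)
  then have "AE w in vm_space p. w \<notin> Z" using Zs by (intro AE_not_in) (auto simp: null_sets_def)
  then show ?thesis using AE_pos_gaps[of p]
  proof eventually_elim
    case (elim w)
    then obtain k where "t' < presum w y k" by (auto simp: Z_def not_le)
    then show ?case by (intro exI[of _ k]) (simp add: t'_def)
  qed
qed

lemma presum_index_unique: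
  assumes "pos_gaps w" "presum w y k \<le> t" "t < presum w y (Suc k)" "presum w y j \<le> t" "t < presum w y (Suc j)"
  shows "k = j"
proof (rule ccontr)
  assume "k \<noteq> j"
  then consider "Suc k \<le> j" | "Suc j \<le> k" by linarith
  then show False
    using presum_mono[OF assms(1), of "Suc k" j y] presum_mono[OF assms(1), of "Suc j" k y] assms by cases auto
qed

text \<open>Memorylessness: split according to the index \<open>k\<close> of the gap that straddles \<open>t\<close>, and integrate out the
  coordinates \<open>(y, k)\<close> and \<open>(y, Suc k)\<close>, on which \<open>W\<close> does not depend.\<close>

lemma emeasure_fut:
  assumes W[measurable]: "Measurable.pred (vm_space p) W" and det: "past_det y t W"
    and t: "0 \<le> t" and d: "0 \<le> d"
    and B[measurable]: "B \<in> sets (borel \<Otimes>\<^sub>M count_space UNIV)" and Bpos: "\<And>e m. (e, m) \<in> B \<Longrightarrow> 0 < e"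
  shows "emeasure (vm_space p) {w. W w \<and> pos_gaps w \<and> fut w y t B d} =
     exp (- d) * emeasure (mark_space p) B * emeasure (vm_space p) {w. W w \<and> pos_gaps w}"
proof -
  define A where "A k = {w. W w \<and> pos_gaps w \<and> presum w y k \<le> t \<and> t < presum w y (Suc k)}" for k
  define A1 where "A1 k = {w. (W w \<and> presum w y k \<le> t \<and> t < presum w y (Suc k) \<and>
     (presum w y (Suc k) - t, snd (w (y, k))) \<in> B) \<and> pos_gaps w}" for k
  define A2 where "A2 k = {w. (W w \<and> presum w y k \<le> t \<and> t < presum w y (Suc k) \<and>
     (presum w y (Suc k) - t, snd (w (y, k))) \<in> B) \<and> pos_gaps w \<and> d < fst (w (y, Suc k))}" for k
  have A_s[measurable]: "A k \<in> sets (vm_space p)" for k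
  proof -
    have "{w \<in> space (vm_space p). W w \<and> pos_gaps w \<and> presum w y k \<le> t \<and> t < presum w y (Suc k)} \<in> sets (vm_space p)" by measurable
    then show ?thesis by (simp add: A_def)
  qed
  have A1_s[measurable]: "A1 k \<in> sets (vm_space p)" for k
  proof -
    have "{w \<in> space (vm_space p). (W w \<and> presum w y k \<le> t \<and> t < presum w y (Suc k) \<and>
     (presum w y (Suc k) - t, snd (w (y, k))) \<in> B) \<and> pos_gaps w} \<in> sets (vm_space p)" by measurable
    then show ?thesis by (simp add: A1_def)
  qed
  have A2_s[measurable]: "A2 k \<in> sets (vm_space p)" for k
  proof -
    have "{w \<in> space (vm_space p). (W w \<and> presum w y k \<le> t \<and> t < presum w y (Suc k) \<and>
     (presum w y (Suc k) - t, snd (w (y, k))) \<in> B) \<and> pos_gaps w \<and> d < fst (w (y, Suc k))} \<in> sets (vm_space p)" by measurable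
    then show ?thesis by (simp add: A2_def)
  qed
  have detD: "W w'" if "pos_gaps w" "pos_gaps w'" "\<And>i. fst i \<noteq> y \<or> snd i < k \<Longrightarrow> w i = w' i" "presum w y k \<le> t"
    "t < presum w y (Suc k)" "t < presum w' y (Suc k)" "W w" for w w' k
    using det that unfolding past_det_def by blast
  have e2: "emeasure (vm_space p) (A2 k) = exp (- d) * emeasure (vm_space p) (A1 k)" for k
    unfolding A2_def A1_def
  proof (rule emeasure_coord_gt)
    fix w :: vm_omega and v v'
    let ?w = "w((y, Suc k) := v)" and ?w' = "w((y, Suc k) := v')"
    assume p: "pos_gaps ?w" "pos_gaps ?w'" and *: "W ?w \<and> presum ?w y k \<le> t \<and> t < presum ?w y (Suc k) \<and>
       (presum ?w y (Suc k) - t, snd (?w (y, k))) \<in> B"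
    have eq: "presum ?w y (Suc k) = presum ?w' y (Suc k)" "presum ?w y k = presum ?w' y k"
      by (intro presum_cong; simp)+
    have "W ?w'" using p * eq by (intro detD[of ?w ?w' k]) auto
    then show "W ?w' \<and> presum ?w' y k \<le> t \<and> t < presum ?w' y (Suc k) \<and>
       (presum ?w' y (Suc k) - t, snd (?w' (y, k))) \<in> B"
      using * eq by auto
  qed (use d in measurable)
  have e1: "emeasure (vm_space p) (A1 k) = emeasure (mark_space p) B * emeasure (vm_space p) (A k)" for k
  proof (rule emeasure_vm_scale[where i="(y, k)", OF A_s A1_s])
    fix X
    define r where "r = t - presum X y k"
    \<comment> \<open>The gap straddles \<open>t\<close> exactly when \<open>r\<close> is
      nonnegative and the gap exceeds \<open>r\<close>. The value \<open>r + 1\<close> is one such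
      gap, and \<open>past_det\<close> makes \<open>W\<close> independent of the choice.\<close>
    define c where "c \<longleftrightarrow> W (X((y, k) := (r + 1, 0))) \<and> 0 \<le> r \<and> (\<forall>j. j \<noteq> (y, k) \<longrightarrow> 0 < fst (X j))"
    have e: "W (X((y, k) := v)) \<and> pos_gaps (X((y, k) := v)) \<and> presum X y k \<le> t \<and> t < presum X y k + fst v \<longleftrightarrow> c \<and> r < fst v" for v
    proof -
      have 1: "W (X((y, k) := v'))" if "W (X((y, k) := v))" "pos_gaps (X((y, k) := v))" "pos_gaps (X((y, k) := v'))"
         "presum X y k \<le> t" "t < presum X y k + fst v" "t < presum X y k + fst v'" for v v'
        by (rule detD[of "X((y, k) := v)" _ k]) (use that in auto)
      show ?thesis
      proof
        assume L: "W (X((y, k) := v)) \<and> pos_gaps (X((y, k) := v)) \<and> presum X y k \<le> t \<and> t < presum X y k + fst v"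
        then have r: "0 \<le> r" "r < fst v" by (auto simp: r_def)
        have p: "pos_gaps (X((y, k) := (r + 1, 0)))" using L r unfolding pos_upd by auto
        have "W (X((y, k) := (r + 1, 0)))"
          by (rule 1[OF _ _ p]) (use L r in \<open>auto simp: r_def\<close>)
        then show "c \<and> r < fst v" using p r unfolding c_def pos_upd by blast
      next
        assume R: "c \<and> r < fst v"
        then have r: "0 \<le> r" "r < fst v" by (auto simp: c_def)
        have p: "pos_gaps (X((y, k) := v))" "pos_gaps (X((y, k) := (r + 1, 0)))"
          using R r unfolding pos_upd c_def by auto
        have "W (X((y, k) := v))"
          by (rule 1[OF _ p(2) p(1)]) (use R r in \<open>auto simp: r_def c_def\<close>)
        then show "W (X((y, k) := v)) \<and> pos_gaps (X((y, k) := v)) \<and> presum X y k \<le> t \<and> t < presum X y k + fst v"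
          using p(1) r by (simp add: r_def)
      qed
    qed
    have "{v. X((y, k) := v) \<in> A k} = (if c then {(e, m). (e - r, m) \<in> {0<..} \<times> UNIV} else {})"
    proof -
      have "X((y, k) := v) \<in> A k \<longleftrightarrow> c \<and> r < fst v" for v
        unfolding e[symmetric] by (simp add: A_def)
      then show ?thesis by auto
    qed
    moreover have "{v. X((y, k) := v) \<in> A1 k} = (if c then {(e, m). (e - r, m) \<in> B} else {})"
    proof -
      have "X((y, k) := v) \<in> A1 k \<longleftrightarrow> (c \<and> r < fst v) \<and> (fst v - r, snd v) \<in> B" for v
        unfolding e[symmetric] by (auto simp: A1_def r_def algebra_simps)
      then have "{v. X((y, k) := v) \<in> A1 k} = {v. c \<and> (fst v - r, snd v) \<in> B}"
        using Bpos by fastforce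
      then show ?thesis by (cases c) (simp_all add: split_beta')
    qed
    moreover have "c \<Longrightarrow> 0 \<le> r" by (simp add: c_def)
    ultimately show "emeasure (mark_space p) {v. X((y, k) := v) \<in> A1 k} =
         emeasure (mark_space p) B * emeasure (mark_space p) {v. X((y, k) := v) \<in> A k}"
      using emeasure_mark_shift[OF B Bpos, where r=r and p=p] emeasure_mark_shift[where B="{0<..} \<times> UNIV" and r=r and p=p]
      by (auto simp: emeasure_mark_Times emeasure_exp_pos mult.commute)
  qed
  have "emeasure (vm_space p) {w. W w \<and> pos_gaps w \<and> fut w y t B d} = emeasure (vm_space p) (\<Union>k. A2 k)"
    by (rule arg_cong[where f="emeasure _"]) (auto simp: fut_def A2_def)
  also have "\<dots> = (\<Sum>k. emeasure (vm_space p) (A2 k))"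
  proof (rule suminf_emeasure[symmetric])
    show "disjoint_family A2"
      unfolding disjoint_family_on_def
    proof (intro ballI impI)
      fix j k :: nat assume "j \<noteq> k"
      then show "A2 j \<inter> A2 k = {}"
        using presum_index_unique[of _ y j t k] by (auto simp: A2_def)
    qed
  qed auto
  also have "\<dots> = (\<Sum>k. (exp (- d) * emeasure (mark_space p) B) * emeasure (vm_space p) (A k))"
    by (simp add: e1 e2 mult.assoc)
  also have "\<dots> = (exp (- d) * emeasure (mark_space p) B) * (\<Sum>k. emeasure (vm_space p) (A k))"
    by (rule ennreal_suminf_cmult)
  also have "(\<Sum>k. emeasure (vm_space p) (A k)) = emeasure (vm_space p) (\<Union>k. A k)"
  proof (rule suminf_emeasure)
    show "disjoint_family A"
      unfolding disjoint_family_on_def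
    proof (intro ballI impI)
      fix j k :: nat assume "j \<noteq> k"
      then show "A j \<inter> A k = {}"
        using presum_index_unique[of _ y j t k] by (auto simp: A_def)
    qed
  qed auto
  also have "\<dots> = emeasure (vm_space p) {w. W w \<and> pos_gaps w}"
  proof (rule emeasure_eq_AE)
    show "AE w in vm_space p. (w \<in> (\<Union>k. A k)) = (w \<in> {w. W w \<and> pos_gaps w})"
      using AE_presum_unbounded[where p=p and t=t and y=y]
    proof eventually_elim
      case (elim w)
      define k where "k = (LEAST k. t < presum w y k)"
      have k: "t < presum w y k" unfolding k_def using elim by (rule LeastI_ex)
      then have "k \<noteq> 0" using t by (auto simp: presum_def intro: ccontr)
      then obtain j where j: "k = Suc j" by (cases k) auto
      have "\<not> t < presum w y j" using not_less_Least[of j "\<lambda>k. t < presum w y k"] j by (simp add: k_def)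
      then show ?case using k j by (auto simp: A_def not_less)
    qed
    have "{w \<in> space (vm_space p). W w \<and> pos_gaps w} \<in> sets (vm_space p)" by measurable
    then show "{w. W w \<and> pos_gaps w} \<in> sets (vm_space p)" by simp
  qed auto
  finally show ?thesis .
qed

section \<open>Dual walks and the environment before a fixed time\<close>

lemma arr_presum: "arr w y k = presum w y (Suc k)"
  by (simp add: arr_def presum_def lessThan_Suc_atMost)

text \<open>\<open>dual\<close> returns a junk value on an orbit that never becomes constant.
  \<open>reach\<close> records termination together with the endpoint, which is the form suited to
  lower bounds.\<close>

definition reach :: "vm_omega \<Rightarrow> int \<Rightarrow> real \<Rightarrow> int \<Rightarrow> bool" where
  "reach w x t v \<longleftrightarrow> (\<exists>n. bstep w ((bstep w ^^ n) (fstep w x t)) = (bstep w ^^ n) (fstep w x t)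
      \<and> fst ((bstep w ^^ n) (fstep w x t)) = v)"

lemma funpow_fixed: "f ((f ^^ n) z) = (f ^^ n) z \<Longrightarrow> n \<le> m \<Longrightarrow> (f ^^ m) z = (f ^^ n) z"
proof -
  assume fixed: "f ((f ^^ n) z) = (f ^^ n) z" and "n \<le> m"
  from this(2) show ?thesis by (induction m rule: dec_induct) (auto simp: fixed)
qed

lemma reach_dual: "reach w x t v \<Longrightarrow> dual w x t = v"
proof -
  let ?z = "fstep w x t"
  let ?P = "\<lambda>n. bstep w ((bstep w ^^ n) ?z) = (bstep w ^^ n) ?z"
  assume "reach w x t v"
  then obtain n where n: "?P n" "fst ((bstep w ^^ n) ?z) = v" by (auto simp: reach_def)
  have "?P (LEAST n. ?P n)" by (rule LeastI[where P="?P"]) (rule n)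
  moreover have "(LEAST n. ?P n) \<le> n" by (rule Least_le) (rule n)
  ultimately have "(bstep w ^^ n) ?z = (bstep w ^^ (LEAST n. ?P n)) ?z" by (rule funpow_fixed)
  then show ?thesis using n by (auto simp: dual_def Let_def)
qed

text \<open>The first step sees the clock at \<open>x\<close> only through the set of arrivals up to
  the starting time. If that set is empty, the orbits rest at \<open>(x, t)\<close> and
  \<open>(x, t')\<close>, which differ only in the time coordinate.\<close>

lemma reach_mono_time:
  assumes q: "\<And>j. arr w x j \<le> t' \<longleftrightarrow> arr w x j \<le> t" and r: "reach w x t v"
  shows "reach w x t' v"
proof (cases "\<exists>j. arr w x j \<le> t")
  case True
  then have "fstep w x t' = fstep w x t" by (simp add: fstep_def q)
  then show ?thesis using r by (simp add: reach_def)
next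
  case False
  then have n: "\<not> arr w x j \<le> t" "\<not> arr w x j \<le> t'" for j using q by auto
  have f: "fstep w x t = (x, t)" "fstep w x t' = (x, t')" using n by (simp_all add: fstep_def)
  have b: "bstep w (x, t) = (x, t)" "bstep w (x, t') = (x, t')"
    using n by (auto simp: bstep_def dest: less_imp_le)
  have "(bstep w ^^ n) (x, t) = (x, t)" for n using b by (induction n) auto
  then have "v = x" using r f by (auto simp: reach_def)
  then show ?thesis unfolding reach_def f using b by (intro exI[of _ 0]) auto
qed

text \<open>The orbit from \<open>(x, t')\<close> is the orbit from \<open>(x + z, t)\<close> with one step prepended, unless \<open>x + z\<close> has no earlier
  arrival at all.\<close>

lemma reach_jump:
  assumes k: "\<And>j. arr w x j \<le> t' \<longleftrightarrow> j \<le> k" and z: "snd (w (x, k)) = z"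
    and q: "\<And>j. arr w (x + z) j < arr w x k \<longleftrightarrow> arr w (x + z) j \<le> t"
    and r: "reach w (x + z) t v"
  shows "reach w x t' v"
proof -
  let ?s = "arr w x k"
  have "(GREATEST j. j \<le> k) = k" by (rule Greatest_equality) auto
  then have f: "fstep w x t' = (x + z, ?s)" using z by (auto simp: fstep_def k)
  show ?thesis
  proof (cases "\<exists>j. arr w (x + z) j \<le> t")
    case True
    then have "bstep w (x + z, ?s) = fstep w (x + z) t" by (simp add: bstep_def fstep_def q Let_def)
    then have "(bstep w ^^ Suc n) (x + z, ?s) = (bstep w ^^ n) (fstep w (x + z) t)" for n
      by (simp add: funpow_swap1)
    then show ?thesis using r unfolding reach_def f by metis
  next
    case False
    then have n: "\<not> arr w (x + z) j \<le> t" "\<not> arr w (x + z) j < ?s" for j using q by auto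
    have f': "fstep w (x + z) t = (x + z, t)" using n by (simp add: fstep_def)
    have b: "bstep w (x + z, t) = (x + z, t)" "bstep w (x + z, ?s) = (x + z, ?s)"
      using n by (auto simp: bstep_def Let_def dest: less_imp_le)
    have "(bstep w ^^ n) (x + z, t) = (x + z, t)" for n using b by (induction n) auto
    then have "v = x + z" using r f' by (auto simp: reach_def)
    then show ?thesis unfolding reach_def f using b by (intro exI[of _ 0]) auto
  qed
qed

text \<open>The straddling index \<open>k\<close> counts the arrivals up to \<open>t\<close>,
  because the arrival with index \<open>j\<close> is the sum of \<open>j + 1\<close> gaps.\<close>

lemma arr_le_iff:
  assumes "pos_gaps w" "presum w y k \<le> t" "t < presum w y (Suc k)"
  shows "arr w y j \<le> t \<longleftrightarrow> j < k"
  using presum_mono[OF assms(1), of "Suc j" k y] presum_mono[OF assms(1), of "Suc k" "Suc j" y] assms(2,3)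
  by (cases "j < k") (auto simp: arr_presum)

text \<open>The last argument 0 asks only that the following gap be positive, which
  \<open>pos_gaps\<close> grants.\<close>

definition silent :: "vm_omega \<Rightarrow> int \<Rightarrow> real \<Rightarrow> real \<Rightarrow> bool" where
  "silent w y t h \<longleftrightarrow> fut w y t ({h<..} \<times> UNIV) 0"

text \<open>Requiring the next gap to exceed \<open>h\<close> is slightly stronger than excluding a
  second ring before \<open>t + h\<close>. The loss is of order \<open>h ^ 2\<close>, and in
  exchange the probability becomes a plain product.\<close>

definition rings_once :: "vm_omega \<Rightarrow> int \<Rightarrow> real \<Rightarrow> real \<Rightarrow> int \<Rightarrow> bool" where
  "rings_once w y t h z \<longleftrightarrow> fut w y t ({0<..h} \<times> {z}) h"

lemma stay_arr:
  assumes "pos_gaps w" "silent w y t h" "0 \<le> h" "t \<le> s" "s \<le> t + h"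
  shows "arr w y j \<le> s \<longleftrightarrow> arr w y j \<le> t" 
proof -
  obtain k where k: "presum w y k \<le> t" "t < presum w y (Suc k)" "t + h < presum w y (Suc k)"
    using assms(2) by (auto simp: silent_def fut_def)
  then show ?thesis
    using arr_le_iff[OF assms(1), of y k t j] arr_le_iff[OF assms(1), of y k s j] assms(4,5) by auto
qed

lemma stay_arr_less:
  assumes "pos_gaps w" "silent w y t h" "0 \<le> h" "t < s" "s \<le> t + h"
  shows "arr w y j < s \<longleftrightarrow> arr w y j \<le> t"
proof -
  obtain k where k: "presum w y k \<le> t" "t < presum w y (Suc k)" "t + h < presum w y (Suc k)"
    using assms(2) by (auto simp: silent_def fut_def)
  then show ?thesis
    using arr_le_iff[OF assms(1), of y k t j] arr_le_iff[OF assms(1), of y k s j] assms(4,5) by auto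
qed

lemma reach_stay:
  assumes "pos_gaps w" "silent w x t h" "0 \<le> h" "reach w x t v"
  shows "reach w x (t + h) v"
  using assms stay_arr[OF assms(1-3), of "t + h"] by (intro reach_mono_time[of w x "t + h" t]) auto

text \<open>The ring in the window is the latest arrival at \<open>x\<close>, so the walk from
  \<open>(x, t + h)\<close> moves to \<open>x + z\<close> at the time of the ring. Silence at
  \<open>x + z\<close> makes it continue like the walk from \<open>(x + z, t)\<close>. For
  \<open>z = 0\<close> the site is \<open>x\<close> itself, whose arrivals strictly before the ring
  are those up to \<open>t\<close>.\<close>

lemma reach_ring:
  assumes p: "pos_gaps w" and r: "rings_once w x t h z" and h: "0 \<le> h" and z: "z = 0 \<or> silent w (x + z) t h"
    and R: "reach w (x + z) t v"
  shows "reach w x (t + h) v"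
proof -
  obtain k where k: "presum w x k \<le> t" "t < presum w x (Suc k)" "presum w x (Suc k) \<le> t + h"
      "snd (w (x, k)) = z" "h < fst (w (x, Suc k))"
    using r by (auto simp: rings_once_def fut_def)
  have k2: "t + h < presum w x (Suc (Suc k))" using k by (simp add: presum_Suc)
  show ?thesis
  proof (rule reach_jump[OF _ k(4) _ R])
    show "arr w x j \<le> t + h \<longleftrightarrow> j \<le> k" for j
      using arr_le_iff[OF p k(3) k2, of j] by (simp add: less_Suc_eq_le)
    show "arr w (x + z) j < arr w x k \<longleftrightarrow> arr w (x + z) j \<le> t" for j
    proof (cases "z = 0")
      case True
      have "arr w x j < arr w x k \<longleftrightarrow> j < k"
        using presum_strict_mono[OF p, of "Suc j" "Suc k" x] presum_mono[OF p, of "Suc k" "Suc j" x]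
        by (cases "j < k") (auto simp: arr_presum)
      then show ?thesis using True arr_le_iff[OF p k(1,2), of j] by simp
    next
      case False
      with z have "silent w (x + z) t h" by simp
      from stay_arr_less[OF p this h, of "arr w x k" j] show ?thesis
        using k by (auto simp: arr_presum)
    qed
  qed
qed

lemma stay_ring_disjoint: "pos_gaps w \<Longrightarrow> silent w x t h \<Longrightarrow> rings_once w x t h z \<Longrightarrow> False"
  unfolding silent_def rings_once_def fut_def
  using presum_index_unique[of w x _ t] by fastforce

lemma ring_ring_disjoint: "pos_gaps w \<Longrightarrow> rings_once w x t h z \<Longrightarrow> rings_once w x t h z' \<Longrightarrow> z = z'"
  unfolding rings_once_def fut_def
  using presum_index_unique[of w x _ t] by fastforce

text \<open>With \<open>pos_gaps\<close>, it bounds the index sets of the \<open>GREATEST\<close> in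
  \<open>fstep\<close> and \<open>bstep\<close> at times up to \<open>t\<close>, so that these never
  return junk values.\<close>

definition nonexplosive :: "vm_omega \<Rightarrow> real \<Rightarrow> bool" where
  "nonexplosive w t \<longleftrightarrow> (\<forall>y. \<exists>k. t < presum w y k)"

section \<open>The dual walk depends only on the past\<close>

lemma fstep_time_le:
  assumes "pos_gaps w" "nonexplosive w t"
  shows "snd (fstep w x t) \<le> t"
proof (cases "\<exists>k. arr w x k \<le> t")
  case True
  obtain b where b: "t < presum w x b" using assms(2) by (auto simp: nonexplosive_def)
  have "arr w x (GREATEST k. arr w x k \<le> t) \<le> t"
  proof (rule GreatestI_ex_nat[OF True, of b])
    fix j assume "arr w x j \<le> t"
    then show "j \<le> b" using b presum_mono[OF assms(1), of b "Suc j" x] by (cases "j \<le> b") (auto simp: arr_presum)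
  qed
  then show ?thesis using True by (simp add: fstep_def Let_def)
qed (simp add: fstep_def)

lemma bstep_time_le:
  assumes "pos_gaps w" "nonexplosive w t" "s \<le> t"
  shows "snd (bstep w (x, s)) \<le> s"
proof (cases "\<exists>k. arr w x k < s")
  case True
  obtain b where b: "t < presum w x b" using assms(2) by (auto simp: nonexplosive_def)
  have "arr w x (GREATEST k. arr w x k < s) < s"
  proof (rule GreatestI_ex_nat[OF True, of b])
    fix j assume "arr w x j < s"
    then show "j \<le> b" using b assms(3) presum_mono[OF assms(1), of b "Suc j" x] by (cases "j \<le> b") (auto simp: arr_presum)
  qed
  then show ?thesis using True by (simp add: bstep_def Let_def)
qed (simp add: bstep_def)

text \<open>The premises of \<open>past_det\<close> in one predicate: \<open>k\<close> is the number
  of arrivals at \<open>y\<close> up to \<open>t\<close>, and the configurations may differ only at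
  \<open>y\<close>, from the straddling gap on.\<close>

definition same_past :: "vm_omega \<Rightarrow> vm_omega \<Rightarrow> int \<Rightarrow> nat \<Rightarrow> real \<Rightarrow> bool" where
  "same_past w w' y k t \<longleftrightarrow> pos_gaps w \<and> pos_gaps w' \<and> (\<forall>i. fst i \<noteq> y \<or> snd i < k \<longrightarrow> w i = w' i) \<and>
     presum w y k \<le> t \<and> t < presum w y (Suc k) \<and> t < presum w' y (Suc k)"

lemma past_det_altdef:
  "past_det y t W \<longleftrightarrow> (\<forall>w w' k. same_past w w' y k t \<longrightarrow> W w \<longrightarrow> W w')"
  unfolding past_det_def same_past_def by blast

lemma same_past_presum:
  assumes "same_past w w' y k t"
  shows "x \<noteq> y \<or> j \<le> k \<Longrightarrow> presum w' x j = presum w x j"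
  using assms by (intro presum_cong) (auto simp: same_past_def)

text \<open>The straddling gap may have different lengths in \<open>w\<close> and \<open>w'\<close>,
  but it ends after \<open>t\<close> in both, so the arrivals up to \<open>t\<close>
  coincide.\<close>

lemma same_past_arr:
  assumes s: "same_past w w' y k t"
  shows "arr w' x j \<le> t \<longleftrightarrow> arr w x j \<le> t"
    and "arr w x j \<le> t \<Longrightarrow> x = y \<Longrightarrow> arr w' x j = arr w x j \<and> w' (x, j) = w (x, j)"
proof -
  have p: "pos_gaps w" "pos_gaps w'" and k: "presum w y k \<le> t" "t < presum w y (Suc k)" "t < presum w' y (Suc k)"
    and k': "presum w' y k \<le> t"
    using s same_past_presum[OF s, of y k] by (auto simp: same_past_def)
  show "arr w' x j \<le> t \<longleftrightarrow> arr w x j \<le> t"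
    using arr_le_iff[OF p(1) k(1,2), of j] arr_le_iff[OF p(2) k' k(3), of j] same_past_presum[OF s, of x "Suc j"]
    by (cases "x = y") (auto simp: arr_presum)
  assume "arr w x j \<le> t" "x = y"
  then have "j < k" using arr_le_iff[OF p(1) k(1,2), of j] by simp
  then show "arr w' x j = arr w x j \<and> w' (x, j) = w (x, j)"
    using same_past_presum[OF s, of x "Suc j"] s \<open>x = y\<close> by (auto simp: arr_presum same_past_def)
qed

lemma same_past_fstep:
  assumes s: "same_past w w' y k t"
  shows "fstep w' x t = fstep w x t"
proof (cases "x = y")
  case False
  then have "arr w' x = arr w x" "\<And>j. w' (x, j) = w (x, j)"
    using same_past_presum[OF s] s by (auto simp: arr_presum fun_eq_iff same_past_def)
  then show ?thesis by (simp add: fstep_def)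
next
  case True
  show ?thesis
  proof (cases "\<exists>j. arr w x j \<le> t")
    case e: True
    let ?G = "GREATEST j. arr w x j \<le> t"
    have p: "pos_gaps w" and k: "presum w y k \<le> t" "t < presum w y (Suc k)" using s by (auto simp: same_past_def)
    have "arr w x ?G \<le> t"
      by (rule GreatestI_ex_nat[OF e, of k]) (use arr_le_iff[OF p k] True in auto)
    from same_past_arr(2)[OF s this True] show ?thesis
      using e by (simp add: fstep_def same_past_arr(1)[OF s] Let_def)
  qed (simp add: fstep_def same_past_arr(1)[OF s])
qed

lemma same_past_bstep:
  assumes s: "same_past w w' y k t" and st: "r \<le> t"
  shows "bstep w' (x, r) = bstep w (x, r)"
proof (cases "x = y")
  case False
  then have "arr w' x = arr w x" "\<And>j. w' (x, j) = w (x, j)"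
    using same_past_presum[OF s] s by (auto simp: arr_presum fun_eq_iff same_past_def)
  then show ?thesis by (simp add: bstep_def)
next
  case True
  have e: "arr w' x j < r \<longleftrightarrow> arr w x j < r" for j
    using same_past_arr(1)[OF s, of x j] same_past_arr(2)[OF s, of x j] st True by auto
  show ?thesis
  proof (cases "\<exists>j. arr w x j < r")
    case ex: True
    let ?G = "GREATEST j. arr w x j < r"
    have p: "pos_gaps w" and k: "presum w y k \<le> t" "t < presum w y (Suc k)" using s by (auto simp: same_past_def)
    have "arr w x ?G < r"
    proof (rule GreatestI_ex_nat[OF ex, of k])
      fix j assume "arr w x j < r"
      then have "arr w x j \<le> t" using st by simp
      then show "j \<le> k" using arr_le_iff[OF p k, of j] True by simp
    qed
    then have "arr w x ?G \<le> t" using st by simp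
    from same_past_arr(2)[OF s this True] show ?thesis
      using ex by (simp add: bstep_def e Let_def)
  qed (simp add: bstep_def e)
qed

text \<open>Orbit times never exceed \<open>t\<close>, so every step reads only arrivals on which
  the two configurations agree. \<open>nonexplosive\<close> is what keeps the orbit times below
  \<open>t\<close>.\<close>

lemma same_past_reach:
  assumes s: "same_past w w' y k t" and n: "nonexplosive w t" and r: "reach w x t v"
  shows "reach w' x t v"
proof -
  have p: "pos_gaps w" using s by (auto simp: same_past_def)
  have "snd ((bstep w ^^ n) (fstep w x t)) \<le> t \<and> (bstep w' ^^ n) (fstep w' x t) = (bstep w ^^ n) (fstep w x t)" for n
  proof (induction n)
    case 0
    then show ?case using fstep_time_le[OF p n] same_past_fstep[OF s] by simp
  next
    case (Suc n)
    obtain a b where ab: "(bstep w ^^ n) (fstep w x t) = (a, b)" by (metis surj_pair)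
    then show ?case using Suc bstep_time_le[OF p n, of b a] same_past_bstep[OF s, of b a] by auto
  qed
  then have o: "snd ((bstep w ^^ n) (fstep w x t)) \<le> t" "(bstep w' ^^ n) (fstep w' x t) = (bstep w ^^ n) (fstep w x t)" for n
    by auto
  have b: "bstep w' ((bstep w ^^ n) (fstep w x t)) = bstep w ((bstep w ^^ n) (fstep w x t))" for n
    using same_past_bstep[OF s o(1)[of n], of "fst ((bstep w ^^ n) (fstep w x t))"] by simp
  show ?thesis using r unfolding reach_def o(2) b .
qed

lemma same_past_nonexp:
  assumes s: "same_past w w' y k t" and n: "nonexplosive w t"
  shows "nonexplosive w' t"
  unfolding nonexplosive_def
proof
  fix x
  show "\<exists>k. t < presum w' x k"
  proof (cases "x = y")
    case True then show ?thesis using s by (auto simp: same_past_def)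
  next
    case False
    obtain j where "t < presum w x j" using n by (auto simp: nonexplosive_def)
    then show ?thesis using same_past_presum[OF s, of x j] False by (intro exI[of _ j]) simp
  qed
qed

lemma past_det_reach: "past_det y t (\<lambda>w. nonexplosive w t \<and> (\<exists>v\<in>S. reach w x t v))"
  unfolding past_det_altdef using same_past_reach same_past_nonexp by blast

lemma past_det_conj: "past_det y t W \<Longrightarrow> past_det y t W' \<Longrightarrow> past_det y t (\<lambda>w. W w \<and> W' w)"
  unfolding past_det_def by blast

lemma past_det_fut: 
  assumes "x \<noteq> y"
  shows "past_det y t (\<lambda>w. fut w x s B d)"
  unfolding past_det_altdef
proof (intro allI impI)
  fix w w' k assume s: "same_past w w' y k t" and f: "fut w x s B d"
  have "presum w' x j = presum w x j" "w' (x, j) = w (x, j)" for j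
    using s same_past_presum[OF s, of x j] assms by (auto simp: same_past_def)
  then show "fut w' x s B d" using f by (simp add: fut_def)
qed

section \<open>Measurability of the dual walk and of the interface ends\<close>

lemma measurable_Greatest[measurable (raw)]:
  assumes [measurable]: "\<And>i::nat. Measurable.pred M (P i)"
  shows "(\<lambda>x. GREATEST i. P i x) \<in> M \<rightarrow>\<^sub>M count_space UNIV"
  unfolding Greatest_def by (rule measurable_THE[where I=UNIV]) (auto intro: antisym)

lemma measurable_arr[measurable]: "(\<lambda>w. arr w y k) \<in> borel_measurable (vm_space p)"
  unfolding arr_presum by measurable

lemma measurable_bstep[measurable (raw)]:
  assumes f[measurable]: "f \<in> vm_space p \<rightarrow>\<^sub>M count_space UNIV \<Otimes>\<^sub>M borel"
  shows "(\<lambda>w. bstep w (f w)) \<in> vm_space p \<rightarrow>\<^sub>M count_space UNIV \<Otimes>\<^sub>M borel"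
proof -
  have 1: "(\<lambda>w. bstep w (y, snd (f w))) \<in> vm_space p \<rightarrow>\<^sub>M count_space UNIV \<Otimes>\<^sub>M borel" for y
  proof -
    have k: "(\<lambda>w. (y + snd (w (y, k)), arr w y k)) \<in> vm_space p \<rightarrow>\<^sub>M count_space UNIV \<Otimes>\<^sub>M borel" for k
      by (intro measurable_Pair measurable_arr measurable_compose[OF measurable_snd_coord]) auto
    have [measurable]: "(\<lambda>w. (y + snd (w (y, GREATEST k. arr w y k < snd (f w))), arr w y (GREATEST k. arr w y k < snd (f w)))) \<in> vm_space p \<rightarrow>\<^sub>M count_space UNIV \<Otimes>\<^sub>M borel"
      by (rule measurable_compose_countable[OF k]) measurable
    show ?thesis unfolding bstep_def Let_def fst_conv snd_conv by measurable
  qed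
  have "(\<lambda>w. bstep w (fst (f w), snd (f w))) \<in> vm_space p \<rightarrow>\<^sub>M count_space UNIV \<Otimes>\<^sub>M borel"
    by (rule measurable_compose_countable[OF 1]) measurable
  then show ?thesis by simp
qed

lemma measurable_fstep[measurable]: "(\<lambda>w. fstep w y t) \<in> vm_space p \<rightarrow>\<^sub>M count_space UNIV \<Otimes>\<^sub>M borel"
proof -
  have k: "(\<lambda>w. (y + snd (w (y, k)), arr w y k)) \<in> vm_space p \<rightarrow>\<^sub>M count_space UNIV \<Otimes>\<^sub>M borel" for k
    by (intro measurable_Pair measurable_arr measurable_compose[OF measurable_snd_coord]) auto
  have [measurable]: "(\<lambda>w. (y + snd (w (y, GREATEST k. arr w y k \<le> t)), arr w y (GREATEST k. arr w y k \<le> t))) \<in> vm_space p \<rightarrow>\<^sub>M count_space UNIV \<Otimes>\<^sub>M borel"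
    by (rule measurable_compose_countable[OF k]) measurable
  show ?thesis unfolding fstep_def Let_def by measurable
qed

lemma measurable_orbit[measurable]:
  "(\<lambda>w. (bstep w ^^ n) (fstep w x t)) \<in> vm_space p \<rightarrow>\<^sub>M count_space UNIV \<Otimes>\<^sub>M borel"
  by (induction n) auto

lemma measurable_orbit_fixed[measurable]:
  "Measurable.pred (vm_space p) (\<lambda>w. bstep w ((bstep w ^^ n) (fstep w x t)) = (bstep w ^^ n) (fstep w x t))"
proof -
  have [measurable]: "(\<lambda>w. snd ((bstep w ^^ m) (fstep w x t))) \<in> borel_measurable (vm_space p)"
    "(\<lambda>w. fst ((bstep w ^^ m) (fstep w x t))) \<in> vm_space p \<rightarrow>\<^sub>M count_space UNIV" for m
    by measurable
  have [measurable]: "Measurable.pred (vm_space p) (\<lambda>w. snd ((bstep w ^^ Suc n) (fstep w x t)) = snd ((bstep w ^^ n) (fstep w x t)))"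
    unfolding pred_def by (rule borel_measurable_eq) measurable
  have "Measurable.pred (vm_space p) (\<lambda>w. (bstep w ^^ Suc n) (fstep w x t) = (bstep w ^^ n) (fstep w x t))"
    unfolding prod_eq_iff by measurable
  then show ?thesis by simp
qed

lemma measurable_reach[measurable]: "Measurable.pred (vm_space p) (\<lambda>w. reach w x t v)"
  unfolding reach_def by measurable

lemma measurable_nonexp[measurable]: "Measurable.pred (vm_space p) (\<lambda>w. nonexplosive w t)"
  unfolding nonexplosive_def by measurable

lemma measurable_stay[measurable]: "Measurable.pred (vm_space p) (\<lambda>w. silent w y t h)"
  unfolding silent_def by (intro measurable_fut) (auto intro!: pair_measureI)

lemma measurable_ring[measurable]: "Measurable.pred (vm_space p) (\<lambda>w. rings_once w y t h z)"
  unfolding rings_once_def by (intro measurable_fut) (auto intro!: pair_measureI)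

lemma AE_nonexp: "AE w in vm_space p. nonexplosive w t"
  unfolding nonexplosive_def by (subst AE_all_countable) (auto intro: AE_presum_unbounded)

lemma measurable_dual[measurable]: "(\<lambda>w. dual w x t) \<in> vm_space p \<rightarrow>\<^sub>M count_space UNIV"
proof -
  let ?P = "\<lambda>w n. bstep w ((bstep w ^^ n) (fstep w x t)) = (bstep w ^^ n) (fstep w x t)"
  have 1: "(\<lambda>w. fst ((bstep w ^^ n) (fstep w x t))) \<in> vm_space p \<rightarrow>\<^sub>M count_space UNIV" for n
    by measurable
  have [measurable]: "(\<lambda>w. fst ((bstep w ^^ (LEAST n. ?P w n)) (fstep w x t))) \<in> vm_space p \<rightarrow>\<^sub>M count_space UNIV"
    by (rule measurable_compose_countable[OF 1]) measurable
  have "(\<lambda>w. if \<exists>n. ?P w n then fst ((bstep w ^^ (LEAST n. ?P w n)) (fstep w x t)) else x)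
    \<in> vm_space p \<rightarrow>\<^sub>M count_space UNIV"
    by measurable
  then show ?thesis unfolding dual_def Let_def .
qed

lemma measurable_voter[measurable]: "Measurable.pred (vm_space p) (\<lambda>w. voter w t x)"
  unfolding voter_def by measurable

text \<open>\<open>Sup\<close> on the integers is a definite description, so measurability of the
  describing predicate suffices, whether or not the set is bounded.\<close>

lemma measurable_Sup_int:
  fixes P :: "int \<Rightarrow> 'a \<Rightarrow> bool"
  assumes [measurable]: "\<And>i. Measurable.pred M (P i)"
  shows "(\<lambda>w. Sup {x. P x w}) \<in> M \<rightarrow>\<^sub>M count_space UNIV"
  unfolding Sup_int_def Ball_def mem_Collect_eq
  by (rule measurable_THE[where I=UNIV]) (auto intro: antisym)

lemma measurable_rmost[measurable]: "(\<lambda>w. rmost w t) \<in> vm_space p \<rightarrow>\<^sub>M count_space UNIV"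
  unfolding rmost_def by (rule measurable_Sup_int) measurable

lemma measurable_lmost[measurable]: "(\<lambda>w. lmost w t) \<in> vm_space p \<rightarrow>\<^sub>M count_space UNIV"
proof -
  have "uminus ` {x. \<not> voter w t x} = {x. \<not> voter w t (- x)}" for w
    by (auto simp: image_iff) (metis add.inverse_inverse)
  then have "lmost w t = - Sup {x. \<not> voter w t (- x)}" for w
    by (simp add: lmost_def Inf_int_def)
  moreover have "(\<lambda>w. Sup {x. \<not> voter w t (- x)}) \<in> vm_space p \<rightarrow>\<^sub>M count_space UNIV"
    by (rule measurable_Sup_int) measurable
  ultimately show ?thesis by simp
qed

section \<open>One-step recursions for the hitting probabilities\<close>

definition hit :: "int set \<Rightarrow> vm_omega \<Rightarrow> int \<Rightarrow> real \<Rightarrow> bool" where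
  "hit S w x t \<longleftrightarrow> (\<exists>v\<in>S. reach w x t v)"

definition one_prob :: "int pmf \<Rightarrow> int set \<Rightarrow> real \<Rightarrow> int \<Rightarrow> real" where
  "one_prob p S t x = measure (vm_space p) {w. hit S w x t}"

definition two_prob :: "int pmf \<Rightarrow> int set \<Rightarrow> int set \<Rightarrow> real \<Rightarrow> int \<Rightarrow> int \<Rightarrow> real" where
  "two_prob p S S' t x y = measure (vm_space p) {w. hit S w x t \<and> hit S' w y t}"

lemma measurable_hit[measurable]: "Measurable.pred (vm_space p) (\<lambda>w. hit S w x t)"
  unfolding hit_def by measurable

lemma sets_vm_pred: "Measurable.pred (vm_space p) P \<Longrightarrow> {w. P w} \<in> sets (vm_space p)"
  by (simp add: pred_def)

lemma hit_iff_dual: "hit S w x t \<Longrightarrow> dual w x t \<in> S"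
  by (auto simp: hit_def dest: reach_dual)

lemma hit_zero: "pos_gaps w \<Longrightarrow> x \<in> S \<Longrightarrow> hit S w x 0"
proof -
  assume p: "pos_gaps w" and x: "x \<in> S"
  have "0 < arr w x k" for k
    using presum_strict_mono[OF p, of 0 "Suc k" x] by (simp add: arr_presum presum_def)
  then have "\<not> arr w x k \<le> 0" "\<not> arr w x k < 0" for k
    by (auto simp: not_le not_less less_imp_le)
  then have "fstep w x 0 = (x, 0)" "bstep w (x, 0) = (x, 0)"
    by (simp_all add: fstep_def bstep_def)
  then show ?thesis using x unfolding hit_def reach_def by (intro bexI[of _ x] exI[of _ 0]) auto
qed

lemma measure_stay:
  assumes W: "Measurable.pred (vm_space p) W" and det: "past_det y t W"
    and t: "0 \<le> t" and h: "0 \<le> h"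
  shows "measure (vm_space p) {w. W w \<and> pos_gaps w \<and> silent w y t h} = exp (- h) * measure (vm_space p) {w. W w \<and> pos_gaps w}"
proof -
  interpret V: prob_space "vm_space p" by (rule prob_space_vm)
  have "emeasure (vm_space p) {w. W w \<and> pos_gaps w \<and> silent w y t h} = exp (- h) * emeasure (vm_space p) {w. W w \<and> pos_gaps w}"
    unfolding silent_def using h
    by (subst emeasure_fut[OF W det t])
      (auto simp: emeasure_mark_Times emeasure_exp_gt intro!: pair_measureI)
  then show ?thesis by (simp add: V.emeasure_eq_measure ennreal_mult'[symmetric])
qed

lemma measure_rings_once:
  assumes W: "Measurable.pred (vm_space p) W" and det: "past_det y t W"
    and t: "0 \<le> t" and h: "0 \<le> h"
  shows "measure (vm_space p) {w. W w \<and> pos_gaps w \<and> rings_once w y t h z} =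
    exp (- h) * (1 - exp (- h)) * pmf p z * measure (vm_space p) {w. W w \<and> pos_gaps w}"
proof -
  interpret V: prob_space "vm_space p" by (rule prob_space_vm)
  have "emeasure (vm_space p) {w. W w \<and> pos_gaps w \<and> rings_once w y t h z} =
      exp (- h) * (ennreal (1 - exp (- h)) * pmf p z) * emeasure (vm_space p) {w. W w \<and> pos_gaps w}"
    unfolding rings_once_def using h
    by (subst emeasure_fut[OF W det t])
      (auto simp: emeasure_mark_Times emeasure_exp_Ioc emeasure_pmf_single intro!: pair_measureI)
  then show ?thesis using h by (simp add: V.emeasure_eq_measure ennreal_mult'[symmetric] ennreal_mult''[symmetric] mult.assoc)
qed

lemma past_det_stay: "x \<noteq> y \<Longrightarrow> past_det y t (\<lambda>w. silent w x s h)"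
  unfolding silent_def by (rule past_det_fut)

text \<open>For \<open>z \<noteq> 0\<close> the two factors \<open>exp (- h)\<close> stand for no
  second ring at \<open>x\<close> and silence at the target. For \<open>z = 0\<close> the target is
  \<open>x\<close>, which cannot be silent while it rings; one factor is then given away to keep the
  bound uniform in \<open>z\<close>.\<close>

lemma measure_move:
  assumes G[measurable]: "Measurable.pred (vm_space p) G" and det: "past_det x t G" "past_det (x + z) t G"
    and t: "0 \<le> t" and h: "0 \<le> h"
  shows "exp (- h) ^ 2 * (1 - exp (- h)) * pmf p z * measure (vm_space p) {w. G w \<and> pos_gaps w}
    \<le> measure (vm_space p) {w. G w \<and> pos_gaps w \<and> rings_once w x t h z \<and> (z = 0 \<or> silent w (x + z) t h)}"
proof (cases "z = 0")
  case True
  have "exp (- h) ^ 2 * (1 - exp (- h)) * pmf p z * measure (vm_space p) {w. G w \<and> pos_gaps w} \<le>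
    exp (- h) * (1 - exp (- h)) * pmf p z * measure (vm_space p) {w. G w \<and> pos_gaps w}"
    using h by (intro mult_right_mono) (auto simp: power2_eq_square mult_le_one)
  then show ?thesis using measure_rings_once[OF G det(1) t h, of z] True by simp
next
  case False
  have "measure (vm_space p) {w. (G w \<and> silent w (x + z) t h) \<and> pos_gaps w \<and> rings_once w x t h z} =
      exp (- h) * (1 - exp (- h)) * pmf p z * measure (vm_space p) {w. (G w \<and> silent w (x + z) t h) \<and> pos_gaps w}"
    using False t h by (intro measure_rings_once past_det_conj past_det_stay det) auto
  also have "{w. (G w \<and> silent w (x + z) t h) \<and> pos_gaps w} = {w. G w \<and> pos_gaps w \<and> silent w (x + z) t h}" by auto
  also have "measure (vm_space p) \<dots> = exp (- h) * measure (vm_space p) {w. G w \<and> pos_gaps w}"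
    by (rule measure_stay[OF G det(2) t h])
  also have "{w. (G w \<and> silent w (x + z) t h) \<and> pos_gaps w \<and> rings_once w x t h z} =
     {w. G w \<and> pos_gaps w \<and> rings_once w x t h z \<and> (z = 0 \<or> silent w (x + z) t h)}" using False by auto
  finally show ?thesis by (simp add: power2_eq_square ac_simps)
qed

lemma measure_good:
  assumes [measurable]: "Measurable.pred (vm_space p) P"
  shows "measure (vm_space p) {w. (nonexplosive w t \<and> P w) \<and> pos_gaps w} = measure (vm_space p) {w. P w}"
proof (rule measure_eq_AE)
  show "AE w in vm_space p. (w \<in> {w. (nonexplosive w t \<and> P w) \<and> pos_gaps w}) = (w \<in> {w. P w})"
    using AE_pos_gaps[of p] AE_nonexp[where p=p and t=t] by eventually_elim auto
qed (auto intro!: sets_vm_pred)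

lemma past_det_hit: "past_det y t (\<lambda>w. nonexplosive w t \<and> hit S w x t)"
  unfolding hit_def by (rule past_det_reach)

lemma past_det_hit2: "past_det y t (\<lambda>w. nonexplosive w t \<and> hit S w x t \<and> hit S' w x' t)"
  using past_det_conj[OF past_det_hit[of y t S x] past_det_hit[of y t S' x']]
  by (simp add: conj_ac cong: conj_cong)

lemma hit_stay: "pos_gaps w \<Longrightarrow> silent w x t h \<Longrightarrow> 0 \<le> h \<Longrightarrow> hit S w x t \<Longrightarrow> hit S w x (t + h)"
  unfolding hit_def using reach_stay by blast

lemma hit_ring: "pos_gaps w \<Longrightarrow> rings_once w x t h z \<Longrightarrow> 0 \<le> h \<Longrightarrow> z = 0 \<or> silent w (x + z) t h \<Longrightarrow>
   hit S w (x + z) t \<Longrightarrow> hit S w x (t + h)"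
  unfolding hit_def using reach_ring by blast

lemma (in finite_measure) measure_disjoint_sum_le:
  assumes Z: "finite Z" and A: "A \<in> sets M" and E: "\<And>z. z \<in> Z \<Longrightarrow> E z \<in> sets M" and T: "T \<in> sets M"
    and sub: "A \<subseteq> T" "\<And>z. z \<in> Z \<Longrightarrow> E z \<subseteq> T"
    and disj: "\<And>z. z \<in> Z \<Longrightarrow> A \<inter> E z = {}" "\<And>z z'. z \<in> Z \<Longrightarrow> z' \<in> Z \<Longrightarrow> z \<noteq> z' \<Longrightarrow> E z \<inter> E z' = {}"
  shows "measure M A + (\<Sum>z\<in>Z. measure M (E z)) \<le> measure M T"
proof -
  have "(\<Sum>z\<in>Z. measure M (E z)) = measure M (\<Union>z\<in>Z. E z)"
    using Z E disj(2) by (intro finite_measure_finite_Union[symmetric]) (auto simp: disjoint_family_on_def)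
  moreover have "measure M A + measure M (\<Union>z\<in>Z. E z) = measure M (A \<union> (\<Union>z\<in>Z. E z))"
    using A Z E disj(1) by (intro finite_measure_Union[symmetric]) auto
  moreover have "\<dots> \<le> measure M T"
    using A Z E T sub by (intro finite_measure_mono) auto
  ultimately show ?thesis by simp
qed

text \<open>In the window after \<open>t\<close> either \<open>x\<close> is silent, or it rings once
  with some mark \<open>z\<close> and \<open>x + z\<close> is silent. These events are disjoint,
  each reduces the question to time \<open>t\<close>, and each is independent of the event at time
  \<open>t\<close>.\<close>

lemma one_prob_step_finite:
  assumes t: "0 \<le> t" and h: "0 \<le> h" and Z: "finite Z"
  shows "exp (- h) * one_prob p S t x + exp (- h) ^ 2 * (1 - exp (- h)) * (\<Sum>z\<in>Z. pmf p z * one_prob p S t (x + z))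
     \<le> one_prob p S (t + h) x"
proof -
  interpret V: prob_space "vm_space p" by (rule prob_space_vm)
  let ?s = "exp (- h)"
  define G where "G x' w \<longleftrightarrow> nonexplosive w t \<and> hit S w x' t" for x' w
  have G[measurable]: "Measurable.pred (vm_space p) (G x')" for x' unfolding G_def by measurable
  have det: "past_det y t (G x')" for y x' unfolding G_def by (rule past_det_hit)
  have mG: "measure (vm_space p) {w. G x' w \<and> pos_gaps w} = one_prob p S t x'" for x'
    unfolding one_prob_def G_def by (rule measure_good) measurable
  define A where "A = {w. G x w \<and> pos_gaps w \<and> silent w x t h}"
  define E where "E z = {w. G (x + z) w \<and> pos_gaps w \<and> rings_once w x t h z \<and> (z = 0 \<or> silent w (x + z) t h)}" for z
  have "?s * one_prob p S t x + (\<Sum>z\<in>Z. ?s ^ 2 * (1 - ?s) * pmf p z * one_prob p S t (x + z))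
     \<le> measure (vm_space p) A + (\<Sum>z\<in>Z. measure (vm_space p) (E z))"
    unfolding A_def E_def mG[symmetric]
    by (intro add_mono sum_mono order.refl measure_move measure_stay[THEN eq_refl, OF G det, THEN ord_eq_le_trans[OF refl]]
        measure_stay[symmetric, THEN eq_refl] G det t h)
  also have "\<dots> \<le> measure (vm_space p) {w. hit S w x (t + h)}"
  proof (rule V.measure_disjoint_sum_le[OF Z])
    show "A \<in> sets (vm_space p)" "{w. hit S w x (t + h)} \<in> sets (vm_space p)" "\<And>z. E z \<in> sets (vm_space p)"
      unfolding A_def E_def by (auto intro!: sets_vm_pred)
    show "A \<subseteq> {w. hit S w x (t + h)}" "\<And>z. E z \<subseteq> {w. hit S w x (t + h)}"
      unfolding A_def E_def G_def using hit_stay hit_ring h by blast+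
    show "A \<inter> E z = {}" for z
      unfolding A_def E_def using stay_ring_disjoint by blast
    show "z \<noteq> z' \<Longrightarrow> E z \<inter> E z' = {}" for z z'
      unfolding E_def using ring_ring_disjoint by blast
  qed
  finally show ?thesis by (simp add: one_prob_def sum_distrib_left mult.assoc)
qed

text \<open>An orbit has one endpoint, so walks that have met contribute nothing. This encodes
  coalescence.\<close>

lemma two_prob_diag:
  assumes "S \<inter> S' = {}"
  shows "two_prob p S S' t x x = 0"
proof -
  have "{w. hit S w x t \<and> hit S' w x t} = {}"
    using assms hit_iff_dual by blast
  then show ?thesis by (simp only: two_prob_def measure_empty)
qed

text \<open>As for a single walk, but at most one of the two moves in the window; the additional
  factor \<open>exp (- h)\<close> is the silence of the other one. The clocks at \<open>x\<close>
  and \<open>y\<close> are independent because \<open>x \<noteq> y\<close>.\<close>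

lemma two_prob_step_finite:
  assumes t: "0 \<le> t" and h: "0 \<le> h" and Z: "finite Z" and SS: "S \<inter> S' = {}" and xy: "x \<noteq> y"
  shows "exp (- h) ^ 2 * two_prob p S S' t x y + exp (- h) ^ 3 * (1 - exp (- h)) *
      (\<Sum>z\<in>Z. pmf p z * (two_prob p S S' t (x + z) y + two_prob p S S' t x (y + z)))
     \<le> two_prob p S S' (t + h) x y"
proof -
  interpret V: prob_space "vm_space p" by (rule prob_space_vm)
  let ?s = "exp (- h)"
  let ?M = "measure (vm_space p)"
  define G where "G x' y' w \<longleftrightarrow> nonexplosive w t \<and> hit S w x' t \<and> hit S' w y' t" for x' y' w
  have G[measurable]: "Measurable.pred (vm_space p) (G x' y')" for x' y' unfolding G_def by measurable
  have det: "past_det y'' t (G x' y')" for y'' x' y' unfolding G_def by (rule past_det_hit2)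
  have mG: "?M {w. G x' y' w \<and> pos_gaps w} = two_prob p S S' t x' y'" for x' y'
    unfolding two_prob_def G_def by (rule measure_good) measurable
  have mS: "?M {w. (G x' y' w \<and> silent w v t h) \<and> pos_gaps w} = ?s * two_prob p S S' t x' y'" for x' y' v
  proof -
    have "{w. (G x' y' w \<and> silent w v t h) \<and> pos_gaps w} = {w. G x' y' w \<and> pos_gaps w \<and> silent w v t h}" by auto
    then show ?thesis using measure_stay[OF G det t h, of x' y' v] mG by simp
  qed
  define A where "A = {w. (G x y w \<and> silent w y t h) \<and> pos_gaps w \<and> silent w x t h}"
  define E1 where "E1 z = {w. (G (x + z) y w \<and> silent w y t h) \<and> pos_gaps w \<and> rings_once w x t h z \<and> (z = 0 \<or> silent w (x + z) t h)}" for z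
  define E2 where "E2 z = {w. (G x (y + z) w \<and> silent w x t h) \<and> pos_gaps w \<and> rings_once w y t h z \<and> (z = 0 \<or> silent w (y + z) t h)}" for z
  \<comment> \<open>The Boolean tells which walk moves, so that all moves form one disjoint
    family.\<close>
  define E where "E b = (if snd b then E1 (fst b) else E2 (fst b))" for b :: "int \<times> bool"
  have mA: "?s ^ 2 * two_prob p S S' t x y = ?M A"
  proof -
    have "?M A = ?s * ?M {w. (G x y w \<and> silent w y t h) \<and> pos_gaps w}"
      unfolding A_def by (rule measure_stay) (use xy t h in \<open>auto intro!: past_det_conj det past_det_stay\<close>)
    then show ?thesis unfolding mS by (simp add: power2_eq_square)
  qed
  \<comment> \<open>A jump onto the other walk has to be set apart, since the target is then the
    site already required to be silent. The left side vanishes in that case.\<close>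
  have mE1: "?s ^ 3 * (1 - ?s) * pmf p z * two_prob p S S' t (x + z) y \<le> ?M (E1 z)" for z
  proof (cases "x + z = y")
    case True
    then show ?thesis by (simp add: two_prob_diag[OF SS])
  next
    case False
    have "?s ^ 2 * (1 - ?s) * pmf p z * ?M {w. (G (x + z) y w \<and> silent w y t h) \<and> pos_gaps w} \<le> ?M (E1 z)"
      unfolding E1_def
      by (rule measure_move) (use xy t h False in \<open>auto intro!: past_det_conj det past_det_stay\<close>)
    then show ?thesis unfolding mS by (simp add: power2_eq_square power3_eq_cube ac_simps)
  qed
  have mE2: "?s ^ 3 * (1 - ?s) * pmf p z * two_prob p S S' t x (y + z) \<le> ?M (E2 z)" for z
  proof (cases "y + z = x")
    case True
    then show ?thesis by (simp add: two_prob_diag[OF SS])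
  next
    case False
    have "?s ^ 2 * (1 - ?s) * pmf p z * ?M {w. (G x (y + z) w \<and> silent w x t h) \<and> pos_gaps w} \<le> ?M (E2 z)"
      unfolding E2_def
      by (rule measure_move) (use xy t h False in \<open>auto intro!: past_det_conj det past_det_stay\<close>)
    then show ?thesis unfolding mS by (simp add: power2_eq_square power3_eq_cube ac_simps)
  qed
  have "?s ^ 3 * (1 - ?s) * (\<Sum>z\<in>Z. pmf p z * (two_prob p S S' t (x + z) y + two_prob p S S' t x (y + z))) =
    (\<Sum>z\<in>Z. ?s ^ 3 * (1 - ?s) * pmf p z * two_prob p S S' t (x + z) y) +
    (\<Sum>z\<in>Z. ?s ^ 3 * (1 - ?s) * pmf p z * two_prob p S S' t x (y + z))"
    by (simp add: sum_distrib_left distrib_left sum.distrib mult.assoc)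
  also have "\<dots> \<le> (\<Sum>z\<in>Z. ?M (E1 z)) + (\<Sum>z\<in>Z. ?M (E2 z))"
    by (intro add_mono sum_mono mE1 mE2)
  also have "\<dots> = (\<Sum>z\<in>Z. \<Sum>b\<in>UNIV. ?M (E (z, b)))"
    by (simp add: E_def UNIV_bool sum.distrib)
  also have "\<dots> = (\<Sum>b\<in>Z \<times> UNIV. ?M (E b))"
    by (subst sum.cartesian_product) simp
  finally have "?s ^ 2 * two_prob p S S' t x y + ?s ^ 3 * (1 - ?s) *
      (\<Sum>z\<in>Z. pmf p z * (two_prob p S S' t (x + z) y + two_prob p S S' t x (y + z)))
     \<le> ?M A + (\<Sum>b\<in>Z \<times> UNIV. ?M (E b))"
    unfolding mA by simp
  also have "\<dots> \<le> ?M {w. hit S w x (t + h) \<and> hit S' w y (t + h)}"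
  proof (rule V.measure_disjoint_sum_le)
    show "finite (Z \<times> (UNIV :: bool set))" using Z by simp
    show "A \<in> sets (vm_space p)" "{w. hit S w x (t + h) \<and> hit S' w y (t + h)} \<in> sets (vm_space p)" "E b \<in> sets (vm_space p)" for b
      unfolding A_def E_def E1_def E2_def by (auto intro!: sets_vm_pred)
    have "A \<subseteq> {w. hit S w x (t + h) \<and> hit S' w y (t + h)}" "E1 z \<subseteq> {w. hit S w x (t + h) \<and> hit S' w y (t + h)}"
      "E2 z \<subseteq> {w. hit S w x (t + h) \<and> hit S' w y (t + h)}" for z
      unfolding A_def E1_def E2_def G_def using hit_stay hit_ring h by blast+
    then show "A \<subseteq> {w. hit S w x (t + h) \<and> hit S' w y (t + h)}" "E b \<subseteq> {w. hit S w x (t + h) \<and> hit S' w y (t + h)}" for b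
      unfolding E_def by auto
    have "A \<inter> E1 z = {}" "A \<inter> E2 z = {}" for z
      unfolding A_def E1_def E2_def using stay_ring_disjoint by blast+
    then show "A \<inter> E b = {}" for b unfolding E_def by auto
    have 1: "E1 z \<inter> E1 z' = {}" "E2 z \<inter> E2 z' = {}" if "z \<noteq> z'" for z z'
      unfolding E1_def E2_def using ring_ring_disjoint that by blast+
    have 2: "E1 z \<inter> E2 z' = {}" for z z'
      unfolding E1_def E2_def using stay_ring_disjoint by blast
    show "E b \<inter> E b' = {}" if "b \<noteq> b'" for b b'
      using that 1[of "fst b" "fst b'"] 2[of "fst b" "fst b'"] 2[of "fst b'" "fst b"]
      unfolding E_def by (cases b; cases b') auto
  qed
  finally show ?thesis by (simp add: two_prob_def)
qed

text \<open>Dominated convergence along the windows \<open>{- int m..int m}\<close> passes from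
  finitely many marks to the full law.\<close>

lemma pmf_expectation_le_of_finite_sums:
  fixes f :: "int \<Rightarrow> real"
  assumes bd: "\<And>z. 0 \<le> f z" "\<And>z. f z \<le> B"
    and le: "\<And>Z. finite Z \<Longrightarrow> a + c * (\<Sum>z\<in>Z. pmf p z * f z) \<le> b"
  shows "a + c * measure_pmf.expectation p f \<le> b"
proof -
  have int: "integrable (measure_pmf p) (\<lambda>z. f z * indicator A z)" for A :: "int set"
    using bd order_trans[OF bd]
    by (intro measure_pmf.integrable_const_bound[where B=B]) (auto simp: indicator_def)
  have "(\<lambda>m. measure_pmf.expectation p (\<lambda>z. f z * indicator {- int m..int m} z)) \<longlonglongrightarrow> measure_pmf.expectation p f"
  proof (rule integral_dominated_convergence[where w="\<lambda>_. B"])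
    show "AE z in measure_pmf p. (\<lambda>m. f z * indicator {- int m..int m} z) \<longlonglongrightarrow> f z"
    proof (rule AE_I2)
      fix z
      have "eventually (\<lambda>m. f z * indicator {- int m..int m} z = f z) sequentially"
        using eventually_ge_at_top[of "nat \<bar>z\<bar>"] by eventually_elim (auto simp: indicator_def)
      then show "(\<lambda>m. f z * indicator {- int m..int m} z) \<longlonglongrightarrow> f z"
        by (rule tendsto_eventually)
    qed
    show "AE z in measure_pmf p. norm (f z * indicator {- int m..int m} z) \<le> B" for m
      using bd order_trans[OF bd] by (intro AE_I2) (auto simp: indicator_def)
  qed auto
  moreover have "measure_pmf.expectation p (\<lambda>z. f z * indicator {- int m..int m} z) = (\<Sum>z\<in>{- int m..int m}. pmf p z * f z)" for m
  proof -
    have "measure_pmf.expectation p (\<lambda>z. f z * indicator {- int m..int m} z) =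
      (\<Sum>z\<in>{- int m..int m}. pmf p z *\<^sub>R (f z * indicator {- int m..int m} z))"
      by (rule integral_measure_pmf) (auto simp: indicator_def)
    then show ?thesis by (simp add: indicator_def)
  qed
  ultimately have "(\<lambda>m. a + c * (\<Sum>z\<in>{- int m..int m}. pmf p z * f z)) \<longlonglongrightarrow> a + c * measure_pmf.expectation p f"
    by (intro tendsto_intros) simp
  then show ?thesis by (rule LIMSEQ_le_const2) (auto intro: le)
qed

lemma one_prob_range: "0 \<le> one_prob p S t x" "one_prob p S t x \<le> 1"
  unfolding one_prob_def using prob_space.prob_le_1[OF prob_space_vm] by auto

lemma two_prob_range: "0 \<le> two_prob p S S' t x y" "two_prob p S S' t x y \<le> 1"
  unfolding two_prob_def using prob_space.prob_le_1[OF prob_space_vm] by auto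

lemma one_prob_step:
  assumes "0 \<le> t" "0 \<le> h"
  shows "exp (- h) * one_prob p S t x + exp (- h) ^ 2 * (1 - exp (- h)) * measure_pmf.expectation p (\<lambda>z. one_prob p S t (x + z))
     \<le> one_prob p S (t + h) x"
  by (rule pmf_expectation_le_of_finite_sums[where B=1]) (auto simp: one_prob_range intro: one_prob_step_finite[OF assms])

lemma two_prob_step:
  assumes "0 \<le> t" "0 \<le> h" "S \<inter> S' = {}" "x \<noteq> y"
  shows "exp (- h) ^ 2 * two_prob p S S' t x y + exp (- h) ^ 3 * (1 - exp (- h)) *
      measure_pmf.expectation p (\<lambda>z. two_prob p S S' t (x + z) y + two_prob p S S' t x (y + z))
     \<le> two_prob p S S' (t + h) x y"
proof (rule pmf_expectation_le_of_finite_sums[where B=2])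
  fix Z :: "int set" assume Z: "finite Z"
  show "exp (- h) ^ 2 * two_prob p S S' t x y + exp (- h) ^ 3 * (1 - exp (- h)) *
      (\<Sum>z\<in>Z. pmf p z * (two_prob p S S' t (x + z) y + two_prob p S S' t x (y + z)))
     \<le> two_prob p S S' (t + h) x y"
    by (rule two_prob_step_finite[OF assms(1,2) Z assms(3,4)])
next
  fix z show "two_prob p S S' t (x + z) y + two_prob p S S' t x (y + z) \<le> 2"
    using two_prob_range(2)[of p S S' t "x + z" y] two_prob_range(2)[of p S S' t x "y + z"] by linarith
qed (simp add: two_prob_range)

lemma one_prob_zero: "x \<in> S \<Longrightarrow> one_prob p S 0 x = 1"
proof -
  interpret V: prob_space "vm_space p" by (rule prob_space_vm)
  assume x: "x \<in> S"
  have "AE w in vm_space p. hit S w x 0" using AE_pos_gaps[of p] by eventually_elim (use x in \<open>auto intro: hit_zero\<close>)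
  then show ?thesis unfolding one_prob_def by (subst V.prob_eq_1) (auto intro!: sets_vm_pred)
qed

lemma two_prob_zero: "x \<in> S \<Longrightarrow> y \<in> S' \<Longrightarrow> two_prob p S S' 0 x y = 1"
proof -
  interpret V: prob_space "vm_space p" by (rule prob_space_vm)
  assume xy: "x \<in> S" "y \<in> S'"
  have "AE w in vm_space p. hit S w x 0 \<and> hit S' w y 0"
    using AE_pos_gaps[of p] by eventually_elim (use xy in \<open>auto intro: hit_zero\<close>)
  then show ?thesis unfolding two_prob_def by (subst V.prob_eq_1) (auto intro!: sets_vm_pred)
qed

section \<open>Finiteness of the interface ends\<close>

text \<open>A lazy random walk in discrete time that dominates the probability that the dual walk does not end in
  \<open>S\<close>, up to an error that is quadratic in the time step; \<open>s + g\<close> may be less than 1.\<close>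

fun miss :: "int pmf \<Rightarrow> real \<Rightarrow> real \<Rightarrow> int set \<Rightarrow> nat \<Rightarrow> int \<Rightarrow> ennreal" where
  "miss p s g S 0 x = indicator (- S) x"
| "miss p s g S (Suc i) x = ennreal s * miss p s g S i x + ennreal g * (\<integral>\<^sup>+z. miss p s g S i (x + z) \<partial>measure_pmf p)"

lemma miss_le_1:
  assumes "0 \<le> s" "0 \<le> g" "s + g \<le> 1"
  shows "miss p s g S i x \<le> 1"
proof (induction i arbitrary: x)
  case (Suc i)
  have "(\<integral>\<^sup>+z. miss p s g S i (x + z) \<partial>measure_pmf p) \<le> (\<integral>\<^sup>+z. 1 \<partial>measure_pmf p)"
    by (intro nn_integral_mono Suc)
  then have "miss p s g S (Suc i) x \<le> ennreal s * 1 + ennreal g * 1"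
    unfolding miss.simps by (intro add_mono mult_left_mono Suc) auto
  also have "\<dots> = ennreal (s + g)" using assms by simp
  also have "\<dots> \<le> 1" using assms(3) by (simp only: ennreal_le_1)
  finally show ?case .
qed (auto simp: indicator_def)

text \<open>The assumption on \<open>S\<close>, satisfied by half-lines, says that translation by
  \<open>z\<close> pushes at most \<open>\<bar>z\<bar>\<close> points out of \<open>S\<close>; each
  of them contributes at most 1.\<close>

lemma sum_miss_shift:
  fixes f :: "int \<Rightarrow> ennreal"
  assumes f1: "\<And>x. f x \<le> 1" and S: "\<And>z. emeasure (count_space UNIV) {y. y - z \<in> S \<and> y \<notin> S} \<le> ennreal \<bar>real_of_int z\<bar>"
  shows "(\<integral>\<^sup>+x. f (x + z) * indicator S x \<partial>count_space UNIV) \<le>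
     (\<integral>\<^sup>+x. f x * indicator S x \<partial>count_space UNIV) + ennreal \<bar>real_of_int z\<bar>"
proof -
  have "bij_betw (\<lambda>x. x + z) UNIV UNIV" by (rule bij_betwI[where g="\<lambda>x. x - z"]) auto
  from nn_integral_bij_count_space[OF this, of "\<lambda>y. f y * indicator S (y - z)"]
  have "(\<integral>\<^sup>+x. f (x + z) * indicator S x \<partial>count_space UNIV) = (\<integral>\<^sup>+y. f y * indicator S (y - z) \<partial>count_space UNIV)"
    by simp
  also have "\<dots> \<le> (\<integral>\<^sup>+y. f y * indicator S y + indicator {y. y - z \<in> S \<and> y \<notin> S} y \<partial>count_space UNIV)"
    using f1 by (intro nn_integral_mono) (auto simp: indicator_def)
  also have "\<dots> = (\<integral>\<^sup>+y. f y * indicator S y \<partial>count_space UNIV) + emeasure (count_space UNIV) {y. y - z \<in> S \<and> y \<notin> S}"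
    by (subst nn_integral_add) auto
  also have "\<dots> \<le> (\<integral>\<^sup>+y. f y * indicator S y \<partial>count_space UNIV) + ennreal \<bar>real_of_int z\<bar>"
    by (intro add_left_mono S)
  finally show ?thesis .
qed

lemma nn_integral_pmf_count_swap:
  fixes f :: "int \<Rightarrow> int \<Rightarrow> ennreal"
  shows "(\<integral>\<^sup>+x. (\<integral>\<^sup>+z. f x z \<partial>measure_pmf p) \<partial>count_space UNIV) = (\<integral>\<^sup>+z. (\<integral>\<^sup>+x. f x z \<partial>count_space UNIV) \<partial>measure_pmf p)"
proof -
  have "(\<integral>\<^sup>+x. (\<integral>\<^sup>+z. f x z \<partial>measure_pmf p) \<partial>count_space UNIV) =
     (\<integral>\<^sup>+x. (\<integral>\<^sup>+z. (\<lambda>(x, z). ennreal (pmf p z) * f x z) (x, z) \<partial>count_space UNIV) \<partial>count_space UNIV)"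
    by (simp add: nn_integral_measure_pmf)
  also have "\<dots> = (\<integral>\<^sup>+z. (\<integral>\<^sup>+x. (\<lambda>(x, z). ennreal (pmf p z) * f x z) (x, z) \<partial>count_space UNIV) \<partial>count_space UNIV)"
    by (simp only: nn_integral_fst_count_space nn_integral_snd_count_space)
  also have "\<dots> = (\<integral>\<^sup>+z. ennreal (pmf p z) * (\<integral>\<^sup>+x. f x z \<partial>count_space UNIV) \<partial>count_space UNIV)"
    by (simp add: nn_integral_cmult)
  also have "\<dots> = (\<integral>\<^sup>+z. (\<integral>\<^sup>+x. f x z \<partial>count_space UNIV) \<partial>measure_pmf p)"
    by (simp add: nn_integral_measure_pmf)
  finally show ?thesis .
qed

text \<open>A flux bound: because \<open>s + g \<le> 1\<close>, the sum over \<open>S\<close> grows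
  in one step only by what enters across the boundary, at most \<open>g\<close> times the first
  absolute moment.\<close>

lemma sum_miss_le:
  assumes sg: "0 \<le> s" "0 \<le> g" "s + g \<le> 1"
    and S: "\<And>z. emeasure (count_space UNIV) {y. y - z \<in> S \<and> y \<notin> S} \<le> ennreal \<bar>real_of_int z\<bar>"
  shows "(\<integral>\<^sup>+x. miss p s g S i x * indicator S x \<partial>count_space UNIV) \<le>
     of_nat i * ennreal g * (\<integral>\<^sup>+z. ennreal \<bar>real_of_int z\<bar> \<partial>measure_pmf p)"
proof (induction i)
  case 0
  have z: "miss p s g S 0 x * indicator S x = 0" for x by (auto simp: indicator_def)
  show ?case unfolding z by simp
next
  case (Suc i)
  let ?f = "miss p s g S i"
  let ?I = "\<integral>\<^sup>+x. ?f x * indicator S x \<partial>count_space UNIV"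
  let ?m = "\<integral>\<^sup>+z. ennreal \<bar>real_of_int z\<bar> \<partial>measure_pmf p"
  have "(\<integral>\<^sup>+x. (\<integral>\<^sup>+z. ?f (x + z) * indicator S x \<partial>measure_pmf p) \<partial>count_space UNIV) =
     (\<integral>\<^sup>+z. (\<integral>\<^sup>+x. ?f (x + z) * indicator S x \<partial>count_space UNIV) \<partial>measure_pmf p)"
    by (rule nn_integral_pmf_count_swap)
  also have "\<dots> \<le> (\<integral>\<^sup>+z. ?I + ennreal \<bar>real_of_int z\<bar> \<partial>measure_pmf p)"
    by (intro nn_integral_mono sum_miss_shift miss_le_1 sg S)
  also have "\<dots> = ?I + ?m"
    by (simp add: nn_integral_add measure_pmf.emeasure_space_1[simplified])
  finally have J: "(\<integral>\<^sup>+x. (\<integral>\<^sup>+z. ?f (x + z) * indicator S x \<partial>measure_pmf p) \<partial>count_space UNIV) \<le> ?I + ?m" .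
  have "(\<integral>\<^sup>+x. miss p s g S (Suc i) x * indicator S x \<partial>count_space UNIV) =
     (\<integral>\<^sup>+x. ennreal s * (?f x * indicator S x) + ennreal g * (\<integral>\<^sup>+z. ?f (x + z) * indicator S x \<partial>measure_pmf p) \<partial>count_space UNIV)"
    by (intro nn_integral_cong) (simp add: distrib_right nn_integral_multc mult.assoc)
  also have "\<dots> = ennreal s * ?I + ennreal g * (\<integral>\<^sup>+x. (\<integral>\<^sup>+z. ?f (x + z) * indicator S x \<partial>measure_pmf p) \<partial>count_space UNIV)"
    by (simp add: nn_integral_add nn_integral_cmult)
  also have "\<dots> \<le> ennreal s * ?I + ennreal g * (?I + ?m)"
    by (intro add_left_mono mult_left_mono J) auto
  also have "\<dots> = ennreal (s + g) * ?I + ennreal g * ?m"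
    using sg by (simp add: ennreal_plus distrib_left distrib_right add.assoc)
  also have "\<dots> \<le> 1 * ?I + ennreal g * ?m"
    using sg(3) by (intro add_mono mult_right_mono) (simp_all only: ennreal_le_1 zero_le order.refl)
  also have "\<dots> \<le> of_nat i * ennreal g * ?m + ennreal g * ?m"
    using Suc by (intro add_mono) auto
  also have "\<dots> = of_nat (Suc i) * ennreal g * ?m"
    by (simp add: distrib_right add.commute)
  finally show ?case .
qed

text \<open>The weights in \<open>one_prob_step\<close> fall short of 1 by
  \<open>1 - s - g = (1 - s) ^ 2 * (1 + s)\<close>, which is at most \<open>2 * h ^ 2\<close>. The
  complementary probability therefore obeys the recursion of \<open>miss\<close> with this additive
  error per step.\<close>

lemma one_prob_miss:
  fixes h :: real
  assumes h: "0 \<le> h"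
  defines "s \<equiv> exp (- h)" and "g \<equiv> exp (- h) ^ 2 * (1 - exp (- h))"
  shows "ennreal (1 - one_prob p S (real i * h) x) \<le> miss p s g S i x + ennreal (real i * (2 * h ^ 2))"
proof (induction i arbitrary: x)
  case 0
  have "ennreal (1 - one_prob p S 0 x) \<le> indicator (- S) x"
    using one_prob_zero[of x S p] one_prob_range[of p S 0 x] by (cases "x \<in> S") (auto simp: ennreal_le_1)
  then show ?case by simp
next
  case (Suc i)
  let ?t = "real i * h"
  have s: "0 \<le> s" "s \<le> 1" "1 - h \<le> s" and g: "0 \<le> g"
    using h exp_ge_add_one_self[of "- h"] by (auto simp: s_def g_def)
  have "g \<le> 1 * (1 - s)"
    unfolding g_def s_def using h by (intro mult_right_mono) (auto simp: power_le_one)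
  then have sg: "s + g \<le> 1" by simp
  have "1 - s - g = (1 - s) * ((1 - s) * (1 + s))"
    unfolding g_def s_def by (simp add: algebra_simps power2_eq_square)
  also have "\<dots> \<le> h * (h * 2)"
    using s by (intro mult_mono) auto
  finally have err: "1 - s - g \<le> 2 * h ^ 2" by (simp add: power2_eq_square)
  have intble: "integrable (measure_pmf p) (\<lambda>z. one_prob p S ?t (x + z))"
    by (intro measure_pmf.integrable_const_bound[where B=1]) (auto simp: one_prob_range)
  have st: "s * one_prob p S ?t x + g * measure_pmf.expectation p (\<lambda>z. one_prob p S ?t (x + z))
     \<le> one_prob p S (real (Suc i) * h) x"
    using one_prob_step[of ?t h p S x] h unfolding s_def g_def by (simp add: distrib_right add.commute)
  have e: "measure_pmf.expectation p (\<lambda>z. 1 - one_prob p S ?t (x + z)) = 1 - measure_pmf.expectation p (\<lambda>z. one_prob p S ?t (x + z))"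
    using intble by (subst Bochner_Integration.integral_diff) (auto simp: measure_pmf.prob_space[simplified])
  have "ennreal (measure_pmf.expectation p (\<lambda>z. 1 - one_prob p S ?t (x + z))) =
     (\<integral>\<^sup>+z. ennreal (1 - one_prob p S ?t (x + z)) \<partial>measure_pmf p)"
    using intble by (intro nn_integral_eq_integral[symmetric]) (auto simp: one_prob_range)
  also have "\<dots> \<le> (\<integral>\<^sup>+z. miss p s g S i (x + z) + ennreal (real i * (2 * h ^ 2)) \<partial>measure_pmf p)"
    by (intro nn_integral_mono Suc)
  also have "\<dots> = (\<integral>\<^sup>+z. miss p s g S i (x + z) \<partial>measure_pmf p) + ennreal (real i * (2 * h ^ 2))"
    by (simp add: nn_integral_add measure_pmf.emeasure_space_1[simplified])
  finally have J: "ennreal (measure_pmf.expectation p (\<lambda>z. 1 - one_prob p S ?t (x + z)))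
     \<le> (\<integral>\<^sup>+z. miss p s g S i (x + z) \<partial>measure_pmf p) + ennreal (real i * (2 * h ^ 2))" .
  have "1 - one_prob p S (real (Suc i) * h) x \<le> (1 - s - g) + s * (1 - one_prob p S ?t x) +
      g * measure_pmf.expectation p (\<lambda>z. 1 - one_prob p S ?t (x + z))"
    unfolding e using st by (simp add: algebra_simps)
  also have "\<dots> \<le> 2 * h ^ 2 + s * (1 - one_prob p S ?t x) +
      g * measure_pmf.expectation p (\<lambda>z. 1 - one_prob p S ?t (x + z))"
    using err by simp
  finally have "ennreal (1 - one_prob p S (real (Suc i) * h) x) \<le> ennreal (2 * h ^ 2 + s * (1 - one_prob p S ?t x) +
      g * measure_pmf.expectation p (\<lambda>z. 1 - one_prob p S ?t (x + z)))"
    by (rule ennreal_leI)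
  also have "\<dots> = ennreal (2 * h ^ 2) + ennreal s * ennreal (1 - one_prob p S ?t x) +
     ennreal g * ennreal (measure_pmf.expectation p (\<lambda>z. 1 - one_prob p S ?t (x + z)))"
    using s g one_prob_range[of p S ?t] by (simp add: ennreal_plus ennreal_mult' integral_nonneg_AE)
  also have "\<dots> \<le> ennreal (2 * h ^ 2) + ennreal s * (miss p s g S i x + ennreal (real i * (2 * h ^ 2))) +
      ennreal g * ((\<integral>\<^sup>+z. miss p s g S i (x + z) \<partial>measure_pmf p) + ennreal (real i * (2 * h ^ 2)))"
    by (intro add_mono mult_left_mono Suc J) auto
  also have "\<dots> = miss p s g S (Suc i) x + (ennreal (2 * h ^ 2) + ennreal (s + g) * ennreal (real i * (2 * h ^ 2)))"
    using s g by (simp add: ennreal_plus distrib_left distrib_right ac_simps)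
  also have "\<dots> \<le> miss p s g S (Suc i) x + (ennreal (2 * h ^ 2) + 1 * ennreal (real i * (2 * h ^ 2)))"
    using sg by (intro add_mono mult_right_mono) (auto simp: ennreal_le_1)
  also have "ennreal (2 * h ^ 2) + 1 * ennreal (real i * (2 * h ^ 2)) = ennreal (real (Suc i) * (2 * h ^ 2))"
    by (simp add: ennreal_plus[symmetric] distrib_right del: ennreal_plus)
  finally show ?case .
qed

text \<open>With mesh \<open>t / (N + 1)\<close> the error at each site is
  \<open>2 * t ^ 2 / (N + 1)\<close>. As \<open>F\<close> is finite it disappears in the limit, and
  the remaining bound does not depend on \<open>F\<close>.\<close>

lemma sum_one_prob_compl:
  assumes first_moment: "(\<lambda>x. \<bar>real_of_int x\<bar> * pmf p x) summable_on UNIV"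
    and S: "\<And>z. emeasure (count_space UNIV) {y. y - z \<in> S \<and> y \<notin> S} \<le> ennreal \<bar>real_of_int z\<bar>"
    and t: "0 \<le> t" and F: "finite F" "F \<subseteq> S"
  shows "(\<Sum>x\<in>F. 1 - one_prob p S t x) \<le> t * (\<Sum>\<^sub>\<infinity>x. \<bar>real_of_int x\<bar> * pmf p x)"
proof -
  define m where "m = (\<Sum>\<^sub>\<infinity>x. \<bar>real_of_int x\<bar> * pmf p x)"
  have m0: "0 \<le> m" unfolding m_def by (intro infsum_nonneg) auto
  have m: "(\<integral>\<^sup>+z. ennreal \<bar>real_of_int z\<bar> \<partial>measure_pmf p) = ennreal m"
  proof -
    let ?f = "\<lambda>x. \<bar>real_of_int x\<bar> * pmf p x"
    have "(\<lambda>x. norm (?f x)) summable_on UNIV" using first_moment by (simp add: abs_mult)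
    note abs = this[unfolded abs_summable_equivalent]
    have "(\<integral>\<^sup>+z. ennreal \<bar>real_of_int z\<bar> \<partial>measure_pmf p) = (\<integral>\<^sup>+z. ennreal (?f z) \<partial>count_space UNIV)"
      by (simp add: nn_integral_measure_pmf ennreal_mult' mult.commute)
    also have "\<dots> = ennreal (infsetsum ?f UNIV)"
      by (rule nn_integral_conv_infsetsum[OF abs]) simp
    also have "infsetsum ?f UNIV = m"
      unfolding m_def by (rule infsetsum_infsum[OF abs])
    finally show ?thesis .
  qed
  have *: "(\<Sum>x\<in>F. 1 - one_prob p S t x) \<le> t * m + card F * (2 * t ^ 2) * (1 / real (Suc N))" for N
  proof -
    define h where "h = t / real (Suc N)"
    have h: "0 \<le> h" "real (Suc N) * h = t" using t by (simp_all add: h_def)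
    let ?s = "exp (- h)" and ?g = "exp (- h) ^ 2 * (1 - exp (- h))"
    have g: "0 \<le> ?g" "?s + ?g \<le> 1" "?g \<le> h"
    proof -
      show "0 \<le> ?g" using h by simp
      have "?g \<le> 1 * (1 - ?s)" using h by (intro mult_right_mono) (auto simp: power_le_one)
      then show "?s + ?g \<le> 1" "?g \<le> h" using exp_ge_add_one_self[of "- h"] by auto
    qed
    have "(\<Sum>x\<in>F. miss p ?s ?g S (Suc N) x * indicator S x) = (\<integral>\<^sup>+x. miss p ?s ?g S (Suc N) x * indicator S x \<partial>count_space F)"
      by (rule nn_integral_count_space_finite[symmetric]) (rule F)
    also have "\<dots> \<le> (\<integral>\<^sup>+x. miss p ?s ?g S (Suc N) x * indicator S x \<partial>count_space UNIV)"
      by (subst nn_integral_count_space_indicator) (auto intro!: nn_integral_mono simp: indicator_def)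
    also have "\<dots> \<le> of_nat (Suc N) * ennreal ?g * ennreal m"
      unfolding m[symmetric] by (rule sum_miss_le) (use g S in auto)
    also have "\<dots> \<le> of_nat (Suc N) * ennreal h * ennreal m"
      using g by (intro mult_right_mono mult_left_mono ennreal_leI) auto
    also have "\<dots> = ennreal (t * m)"
      using h m0 by (simp add: ennreal_mult'[symmetric] ennreal_of_nat_eq_real_of_nat ennreal_mult''[symmetric] del: of_nat_Suc)
    finally have J: "(\<Sum>x\<in>F. miss p ?s ?g S (Suc N) x * indicator S x) \<le> ennreal (t * m)" .
    have "ennreal (\<Sum>x\<in>F. 1 - one_prob p S t x) = (\<Sum>x\<in>F. ennreal (1 - one_prob p S t x))"
      by (simp add: sum_ennreal one_prob_range)
    also have "\<dots> \<le> (\<Sum>x\<in>F. miss p ?s ?g S (Suc N) x + ennreal (real (Suc N) * (2 * h ^ 2)))"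
      using one_prob_miss[OF h(1), of p S "Suc N"] unfolding h(2) by (intro sum_mono)
    also have "\<dots> = (\<Sum>x\<in>F. miss p ?s ?g S (Suc N) x * indicator S x) + card F * ennreal (real (Suc N) * (2 * h ^ 2))"
      using F(2) by (simp add: sum.distrib subset_iff cong: sum.cong del: miss.simps)
    also have "\<dots> \<le> ennreal (t * m) + card F * ennreal (real (Suc N) * (2 * h ^ 2))"
      by (intro add_right_mono J)
    also have "card F * ennreal (real (Suc N) * (2 * h ^ 2)) = ennreal (card F * (2 * t ^ 2) * (1 / real (Suc N)))"
    proof -
      have "real (Suc N) * (2 * h ^ 2) = 2 * t ^ 2 * (1 / real (Suc N))"
        unfolding h_def by (simp add: power2_eq_square divide_simps del: of_nat_Suc)
      then show ?thesis by (simp add: ennreal_mult''[symmetric] ennreal_of_nat_eq_real_of_nat mult.assoc del: of_nat_Suc)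
    qed
    also have "ennreal (t * m) + \<dots> = ennreal (t * m + card F * (2 * t ^ 2) * (1 / real (Suc N)))"
      using t m0 by (simp add: ennreal_plus)
    finally show ?thesis
      using t m0 by (subst (asm) ennreal_le_iff) (auto intro!: add_nonneg_nonneg)
  qed
  have "(\<lambda>N. t * m + card F * (2 * t ^ 2) * (1 / real (Suc N))) \<longlonglongrightarrow> t * m + card F * (2 * t ^ 2) * 0"
    by (intro tendsto_intros LIMSEQ_Suc[OF lim_1_over_n])
  then have "(\<Sum>x\<in>F. 1 - one_prob p S t x) \<le> t * m + card F * (2 * t ^ 2) * 0"
    by (rule LIMSEQ_le_const) (use * in auto)
  then show ?thesis by (simp add: m_def)
qed

text \<open>Borel-Cantelli: the failure probabilities along an injective sequence in
  \<open>S\<close> have partial sums bounded by \<open>t\<close> times the first absolute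
  moment.\<close>

lemma AE_eventually_hit:
  assumes first_moment: "(\<lambda>x. \<bar>real_of_int x\<bar> * pmf p x) summable_on UNIV"
    and S: "\<And>z. emeasure (count_space UNIV) {y. y - z \<in> S \<and> y \<notin> S} \<le> ennreal \<bar>real_of_int z\<bar>"
    and t: "0 \<le> t" and f: "inj f" "range f \<subseteq> S"
  shows "AE w in vm_space p. eventually (\<lambda>n. hit S w (f n) t) sequentially"
proof -
  interpret V: prob_space "vm_space p" by (rule prob_space_vm)
  have mA: "{w. \<not> hit S w x t} \<in> sets (vm_space p)" for x by (intro sets_vm_pred) measurable
  have eqA: "measure (vm_space p) {w. \<not> hit S w x t} = 1 - one_prob p S t x" for x
  proof -
    have "{w. \<not> hit S w x t} = space (vm_space p) - {w. hit S w x t}" by auto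
    then show ?thesis unfolding one_prob_def by (simp only: V.prob_compl sets_vm_pred measurable_hit)
  qed
  have "AE w in vm_space p. eventually (\<lambda>n. w \<in> space (vm_space p) - {w. \<not> hit S w (f n) t}) sequentially"
  proof (rule borel_cantelli_AE1[OF mA])
    show "emeasure (vm_space p) {w. \<not> hit S w (f n) t} < \<infinity>" for n
      by (simp add: V.emeasure_eq_measure)
    show "summable (\<lambda>n. measure (vm_space p) {w. \<not> hit S w (f n) t})"
    proof (rule bounded_imp_summable)
      fix n
      have "(\<Sum>k\<le>n. measure (vm_space p) {w. \<not> hit S w (f k) t}) = (\<Sum>x\<in>f ` {..n}. 1 - one_prob p S t x)"
        using f(1) by (subst sum.reindex) (auto simp: eqA inj_on_def)
      also have "\<dots> \<le> t * (\<Sum>\<^sub>\<infinity>x. \<bar>real_of_int x\<bar> * pmf p x)"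
        using f(2) by (intro sum_one_prob_compl[OF first_moment S t]) auto
      finally show "(\<Sum>k\<le>n. measure (vm_space p) {w. \<not> hit S w (f k) t}) \<le> t * (\<Sum>\<^sub>\<infinity>x. \<bar>real_of_int x\<bar> * pmf p x)" .
    qed simp
  qed
  then show ?thesis by eventually_elim simp
qed

lemma AE_voter_bounded:
  assumes first_moment: "(\<lambda>x. \<bar>real_of_int x\<bar> * pmf p x) summable_on UNIV" and t: "0 \<le> t"
  shows "AE w in vm_space p. bdd_above {x. voter w t x} \<and> bdd_below {x. \<not> voter w t x}"
proof -
  have 1: "AE w in vm_space p. eventually (\<lambda>n. hit {0<..} w (int n + 1) t) sequentially"
  proof (rule AE_eventually_hit[OF first_moment _ t])
    fix z :: int
    have "{y. y - z \<in> {0<..} \<and> y \<notin> {0<..}} = {z<..0}" by auto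
    then show "emeasure (count_space UNIV) {y. y - z \<in> {0<..} \<and> y \<notin> {0<..}} \<le> ennreal \<bar>real_of_int z\<bar>"
      by (simp add: ennreal_of_nat_eq_real_of_nat ennreal_leI)
  qed (auto simp: inj_def)
  have 2: "AE w in vm_space p. eventually (\<lambda>n. hit {..0} w (- int n) t) sequentially"
  proof (rule AE_eventually_hit[OF first_moment _ t])
    fix z :: int
    have "{y. y - z \<in> {..0} \<and> y \<notin> {..0}} = {0<..z}" by auto
    then show "emeasure (count_space UNIV) {y. y - z \<in> {..0} \<and> y \<notin> {..0}} \<le> ennreal \<bar>real_of_int z\<bar>"
      by (simp add: ennreal_of_nat_eq_real_of_nat ennreal_leI)
  qed (auto simp: inj_def)
  show ?thesis using 1 2
  proof eventually_elim
    case (elim w)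
    obtain N where N: "\<And>n. n \<ge> N \<Longrightarrow> hit {0<..} w (int n + 1) t"
      using elim(1) by (auto simp: eventually_sequentially)
    obtain N' where N': "\<And>n. n \<ge> N' \<Longrightarrow> hit {..0} w (- int n) t"
      using elim(2) by (auto simp: eventually_sequentially)
    have "\<not> voter w t x" if "x > int N" for x
    proof -
      have "N \<le> nat (x - 1)" "int (nat (x - 1)) + 1 = x" using that by linarith+
      then show ?thesis using hit_iff_dual[OF N[of "nat (x - 1)"]] by (auto simp: voter_def heaviside_def)
    qed
    then have "bdd_above {x. voter w t x}" by (intro bdd_aboveI[of _ "int N"]) (auto simp: not_less[symmetric])
    moreover have "voter w t x" if "x < - int N'" for x
    proof -
      have "N' \<le> nat (- x)" "- int (nat (- x)) = x" using that by linarith+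
      then show ?thesis using hit_iff_dual[OF N'[of "nat (- x)"]] by (auto simp: voter_def heaviside_def)
    qed
    then have "bdd_below {x. \<not> voter w t x}" by (intro bdd_belowI[of _ "- int N'"]) (auto simp: not_less[symmetric])
    ultimately show ?case ..
  qed
qed

text \<open>Almost sure boundedness licenses \<open>cSup_upper\<close> and
  \<open>cInf_lower\<close>. The inclusion of events is thus only almost sure, which is why
  measurability of the larger event is required.\<close>

lemma two_prob_le_interface:
  assumes first_moment: "(\<lambda>x. \<bar>real_of_int x\<bar> * pmf p x) summable_on UNIV" and t: "0 \<le> t"
    and K: "K < real_of_int (y - x)"
  shows "two_prob p {0<..} {..0} t x y \<le> measure (vm_space p) {w \<in> space (vm_space p). \<bar>real_of_int (rmost w t - lmost w t)\<bar> > K}"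
proof -
  interpret V: prob_space "vm_space p" by (rule prob_space_vm)
  have meas: "{w \<in> space (vm_space p). \<bar>real_of_int (rmost w t - lmost w t)\<bar> > K} \<in> sets (vm_space p)"
    by measurable
  show ?thesis unfolding two_prob_def
  proof (rule V.finite_measure_mono_AE[OF _ meas])
    show "AE w in vm_space p. w \<in> {w. hit {0<..} w x t \<and> hit {..0} w y t} \<longrightarrow>
       w \<in> {w \<in> space (vm_space p). \<bar>real_of_int (rmost w t - lmost w t)\<bar> > K}"
      using AE_voter_bounded[OF first_moment t]
    proof eventually_elim
      case (elim w)
      show ?case
      proof
        assume "w \<in> {w. hit {0<..} w x t \<and> hit {..0} w y t}"
        then have "\<not> voter w t x" "voter w t y"
          using hit_iff_dual[of "{0<..}" w x t] hit_iff_dual[of "{..0}" w y t] by (auto simp: voter_def heaviside_def)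
        then have "y \<le> rmost w t" "lmost w t \<le> x"
          unfolding rmost_def lmost_def using elim by (auto intro: cSup_upper cInf_lower)
        then show "w \<in> {w \<in> space (vm_space p). \<bar>real_of_int (rmost w t - lmost w t)\<bar> > K}"
          using K by simp
      qed
    qed
  qed
qed

section \<open>Two walks and one big jump\<close>

text \<open>Here \<open>u i x y\<close> stands for the crossing probability after \<open>i\<close> time steps of length \<open>- ln s\<close>.\<close>

locale two_walk =
  fixes p :: "int pmf" and n :: int and s R :: real and u :: "nat \<Rightarrow> int \<Rightarrow> int \<Rightarrow> real"
  assumes n_pos: "0 < n" and s: "0 < s" "s < 1" and R: "0 < R"
    and u0: "\<And>i x y. 0 \<le> u i x y" and u1: "\<And>i x y. u i x y \<le> 1"
    and base: "\<And>x y. 0 < x \<Longrightarrow> y \<le> 0 \<Longrightarrow> u 0 x y = 1"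
    and step: "\<And>i x y. x \<noteq> y \<Longrightarrow> s ^ 2 * u i x y + s ^ 3 * (1 - s) *
      measure_pmf.expectation p (\<lambda>z. u i (x + z) y + u i x (y + z)) \<le> u (Suc i) x y"
begin

definition "g = s ^ 3 * (1 - s)"
definition "small = {z::int. \<bar>z\<bar> < n}"
definition "Q = measure_pmf.prob p {z. n \<le> \<bar>z\<bar>}"
definition "\<mu> = measure_pmf.expectation p (\<lambda>z. real_of_int z * indicator small z)"
definition "V = measure_pmf.expectation p (\<lambda>z. real_of_int z ^ 2 * indicator small z)"
definition "\<rho> = s ^ 2 + 2 * g * (1 - Q)"
definition "\<nu> = g * \<mu> / \<rho>"
definition "c = 2 * g * V / (\<rho> * R ^ 2)"
text \<open>The constants \<open>\<rho>\<close>, \<open>\<nu>\<close> and \<open>c\<close> compensate for killing at big jumps, for the drift and for the variance of the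
  small jumps, so that \<open>\<rho> ^ i * \<phi>\<close> is a subsolution of the recursion with the big jumps removed.  It is
  nonpositive on the diagonal, where the recursion fails.\<close>

definition "\<phi> a b i x y = 1 - ((real_of_int x + real i * \<nu> - a) ^ 2 + (real_of_int y + real i * \<nu> - b) ^ 2) / R ^ 2 - c * real i"

lemma g_nonneg: "0 \<le> g"
  using s by (simp add: g_def)

lemma Q_range: "0 \<le> Q" "Q \<le> 1"
  by (auto simp: Q_def)

lemma rho_pos: "0 < \<rho>"
  unfolding \<rho>_def using s Q_range g_nonneg by (intro add_pos_nonneg mult_nonneg_nonneg) auto

text \<open>Even without big jumps the weights add up to \<open>3 * s ^ 2 - 2 * s ^ 3\<close>, which
  is at most 1.\<close>

lemma rho_le_1: "\<rho> \<le> 1"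
proof -
  have "s ^ 3 \<le> s ^ 2" using s by (intro power_decreasing) auto
  then have g: "g \<le> s ^ 2 * (1 - s)" unfolding g_def using s by (intro mult_right_mono) auto
  have "\<rho> \<le> s ^ 2 + 2 * g * 1"
    unfolding \<rho>_def using Q_range g_nonneg by (intro add_left_mono mult_left_mono) auto
  also have "\<dots> \<le> s ^ 2 + 2 * (s ^ 2 * (1 - s))" using g by simp
  also have "\<dots> = 1 - (1 - s) ^ 2 * (1 + 2 * s)" by (simp add: power2_eq_square algebra_simps)
  also have "\<dots> \<le> 1" using s by simp
  finally show ?thesis .
qed

lemma V_nonneg: "0 \<le> V"
  unfolding V_def by (intro integral_nonneg_AE) auto

lemma c_nonneg: "0 \<le> c"
  unfolding c_def using V_nonneg g_nonneg rho_pos R by (intro divide_nonneg_nonneg mult_nonneg_nonneg) auto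

lemma phi_le_1: "\<phi> a b i x y \<le> 1"
proof -
  have "0 \<le> ((real_of_int x + real i * \<nu> - a) ^ 2 + (real_of_int y + real i * \<nu> - b) ^ 2) / R ^ 2" by simp
  moreover have "0 \<le> c * real i" using c_nonneg by simp
  ultimately show ?thesis unfolding \<phi>_def by linarith
qed

lemma phi_nonpos:
  assumes "R ^ 2 \<le> (real_of_int x + real i * \<nu> - a) ^ 2 + (real_of_int y + real i * \<nu> - b) ^ 2"
  shows "\<phi> a b i x y \<le> 0"
proof -
  have "1 \<le> ((real_of_int x + real i * \<nu> - a) ^ 2 + (real_of_int y + real i * \<nu> - b) ^ 2) / R ^ 2"
    using assms R by simp
  moreover have "0 \<le> c * real i" using c_nonneg by simp
  ultimately show ?thesis unfolding \<phi>_def by linarith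
qed

text \<open>By the parallelogram identity the squared distance from a diagonal point to the centre
  is at least half of \<open>(a - b) ^ 2\<close>, so the diagonal misses the disc of radius
  \<open>R\<close>.\<close>

lemma phi_diag:
  assumes "2 * R \<le> \<bar>a - b\<bar>"
  shows "\<phi> a b i x x \<le> 0"
proof (rule phi_nonpos)
  let ?X = "real_of_int x + real i * \<nu> - a" and ?Y = "real_of_int x + real i * \<nu> - b"
  have "(2 * R) ^ 2 \<le> (a - b) ^ 2" using assms R by (metis abs_le_square_iff abs_of_pos mult_pos_pos zero_less_numeral)
  also have "(a - b) ^ 2 = 2 * (?X ^ 2 + ?Y ^ 2) - (?X + ?Y) ^ 2" by (simp add: power2_eq_square algebra_simps)
  also have "\<dots> \<le> 2 * (?X ^ 2 + ?Y ^ 2)" by simp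
  finally have "2 * R ^ 2 \<le> ?X ^ 2 + ?Y ^ 2" by (simp add: power_mult_distrib)
  then show "R ^ 2 \<le> ?X ^ 2 + ?Y ^ 2" using zero_le_power2[of R] by linarith
qed

section \<open>Averages over the small jumps\<close>

lemma integrable_ind_small: "integrable (measure_pmf p) (\<lambda>z. indicator small z :: real)"
  and integrable_id_small: "integrable (measure_pmf p) (\<lambda>z. real_of_int z * indicator small z)"
  and integrable_sq_small: "integrable (measure_pmf p) (\<lambda>z. real_of_int z ^ 2 * indicator small z)"
proof -
  show "integrable (measure_pmf p) (\<lambda>z. indicator small z :: real)"
    by (intro measure_pmf.integrable_const_bound[where B=1]) (auto simp: indicator_def)
  show "integrable (measure_pmf p) (\<lambda>z. real_of_int z * indicator small z)"
    using n_pos by (intro measure_pmf.integrable_const_bound[where B=n]) (auto simp: indicator_def small_def)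
  have "\<bar>real_of_int z\<bar> ^ 2 \<le> real_of_int n ^ 2" if "\<bar>z\<bar> < n" for z
    using that by (intro power_mono) auto
  then show "integrable (measure_pmf p) (\<lambda>z. real_of_int z ^ 2 * indicator small z)"
    using n_pos by (intro measure_pmf.integrable_const_bound[where B="real_of_int n ^ 2"]) (auto simp: indicator_def small_def)
qed

lemma prob_small: "measure_pmf.prob p small = 1 - Q"
proof -
  have "small = space (measure_pmf p) - {z. n \<le> \<bar>z\<bar>}" by (auto simp: small_def)
  then show ?thesis
    unfolding Q_def by (simp only: measure_pmf.prob_compl sets_measure_pmf UNIV_I)
qed

lemma expectation_quadratic_small:
  "measure_pmf.expectation p (\<lambda>z. (A + B * real_of_int z + D * real_of_int z ^ 2) * indicator small z) =
     A * (1 - Q) + B * \<mu> + D * V"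
proof -
  have "(\<lambda>z. (A + B * real_of_int z + D * real_of_int z ^ 2) * indicator small z) =
     (\<lambda>z. A * indicator small z + B * (real_of_int z * indicator small z) + D * (real_of_int z ^ 2 * indicator small z))"
    by (auto simp: algebra_simps)
  then show ?thesis
    using integrable_ind_small integrable_id_small integrable_sq_small
    by (simp add: prob_small \<mu>_def V_def)
qed

lemma integrable_quadratic_small:
  "integrable (measure_pmf p) (\<lambda>z. (A + B * real_of_int z + D * real_of_int z ^ 2) * indicator small z)"
proof -
  have "(\<lambda>z. (A + B * real_of_int z + D * real_of_int z ^ 2) * indicator small z) =
     (\<lambda>z. A * indicator small z + B * (real_of_int z * indicator small z) + D * (real_of_int z ^ 2 * indicator small z))"
    by (auto simp: algebra_simps)
  then show ?thesis
    using integrable_ind_small integrable_id_small integrable_sq_small by simp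
qed

lemma integrable_u: "integrable (measure_pmf p) (\<lambda>z. (u i (x + z) y + u i x (y + z)) * indicator A z)"
proof (rule measure_pmf.integrable_const_bound[where B=2])
  show "AE z in measure_pmf p. norm ((u i (x + z) y + u i x (y + z)) * indicator A z) \<le> 2"
  proof (rule AE_I2)
    fix z
    have "\<bar>u i (x + z) y + u i x (y + z)\<bar> \<le> 2"
      using u0[of i "x + z" y] u0[of i x "y + z"] u1[of i "x + z" y] u1[of i x "y + z"] by linarith
    then show "norm ((u i (x + z) y + u i x (y + z)) * indicator A z) \<le> 2" by (auto simp: indicator_def)
  qed
qed simp

definition "big_part i x y = measure_pmf.expectation p (\<lambda>z. (u i (x + z) y + u i x (y + z)) * indicator (- small) z)"

lemma big_part_nonneg: "0 \<le> big_part i x y"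
  unfolding big_part_def using u0 by (intro integral_nonneg_AE) auto

text \<open>Since \<open>\<phi>\<close> is quadratic, its average over small jumps is computed
  exactly from \<open>\<mu>\<close> and \<open>V\<close>; the shift by \<open>\<nu>\<close> absorbs
  the linear term and \<open>c\<close> the quadratic one. The contribution of the big jumps is kept
  as a separate surplus, and the free factor \<open>K\<close> serves both comparison arguments
  below.\<close>

lemma step_lower:
  assumes xy: "x \<noteq> y" and K: "0 \<le> K" and le: "\<And>x y. K * \<phi> a b i x y \<le> u i x y"
  shows "K * \<rho> * \<phi> a b (Suc i) x y + g * big_part i x y \<le> u (Suc i) x y"
proof -
  let ?E = "measure_pmf.expectation p"
  let ?X = "real_of_int x + real i * \<nu> - a" and ?Y = "real_of_int y + real i * \<nu> - b"
  let ?F = "\<phi> a b i x y"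
  have ex: "K * \<phi> a b i (x + z) y + K * \<phi> a b i x (y + z) =
     2 * K * ?F + (- 2 * K * (?X + ?Y) / R ^ 2) * real_of_int z + (- 2 * K / R ^ 2) * real_of_int z ^ 2" for z
    unfolding \<phi>_def using R by (simp add: field_simps power2_eq_square)
  have "2 * K * ?F * (1 - Q) + (- 2 * K * (?X + ?Y) / R ^ 2) * \<mu> + (- 2 * K / R ^ 2) * V
     = ?E (\<lambda>z. (K * \<phi> a b i (x + z) y + K * \<phi> a b i x (y + z)) * indicator small z)"
    unfolding ex by (rule expectation_quadratic_small[symmetric])
  also have "\<dots> \<le> ?E (\<lambda>z. (u i (x + z) y + u i x (y + z)) * indicator small z)"
  proof (rule integral_mono)
    show "integrable (measure_pmf p) (\<lambda>z. (K * \<phi> a b i (x + z) y + K * \<phi> a b i x (y + z)) * indicator small z)"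
      unfolding ex by (rule integrable_quadratic_small)
    show "(K * \<phi> a b i (x + z) y + K * \<phi> a b i x (y + z)) * indicator small z \<le>
        (u i (x + z) y + u i x (y + z)) * indicator small z" for z
      by (intro mult_right_mono add_mono le) auto
  qed (rule integrable_u)
  finally have sm: "2 * K * ?F * (1 - Q) + (- 2 * K * (?X + ?Y) / R ^ 2) * \<mu> + (- 2 * K / R ^ 2) * V \<le>
     ?E (\<lambda>z. (u i (x + z) y + u i x (y + z)) * indicator small z)" .
  have "?E (\<lambda>z. u i (x + z) y + u i x (y + z)) =
    ?E (\<lambda>z. (u i (x + z) y + u i x (y + z)) * indicator small z + (u i (x + z) y + u i x (y + z)) * indicator (- small) z)"
    by (intro Bochner_Integration.integral_cong) (auto simp: indicator_def)
  also have "\<dots> = ?E (\<lambda>z. (u i (x + z) y + u i x (y + z)) * indicator small z) + big_part i x y"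
    unfolding big_part_def by (intro Bochner_Integration.integral_add integrable_u)
  finally have sp: "?E (\<lambda>z. u i (x + z) y + u i x (y + z)) =
     ?E (\<lambda>z. (u i (x + z) y + u i x (y + z)) * indicator small z) + big_part i x y" .
  have nu: "\<rho> * \<nu> = g * \<mu>" and cc: "\<rho> * c = 2 * g * V / R ^ 2"
    unfolding \<nu>_def c_def using rho_pos R by simp_all
  have "\<phi> a b (Suc i) x y = ?F - (2 * \<nu> * (?X + ?Y) + 2 * \<nu> ^ 2) / R ^ 2 - c"
    unfolding \<phi>_def using R by (simp add: field_simps power2_eq_square)
  moreover have "\<rho> * (F - (2 * \<nu> * S + 2 * \<nu> ^ 2) / r - c) =
      \<rho> * F - (2 * (\<rho> * \<nu>) * S) / r - 2 * \<rho> * \<nu> ^ 2 / r - \<rho> * c" for F S r :: real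
    by (simp add: algebra_simps add_divide_distrib)
  ultimately have "\<rho> * \<phi> a b (Suc i) x y = \<rho> * ?F - (2 * (\<rho> * \<nu>) * (?X + ?Y)) / R ^ 2 - 2 * \<rho> * \<nu> ^ 2 / R ^ 2 - \<rho> * c"
    by metis
  \<comment> \<open>The term in \<open>\<nu> ^ 2\<close> has a favourable sign and is
    dropped.\<close>
  also have "\<dots> \<le> \<rho> * ?F - (2 * (g * \<mu>) * (?X + ?Y)) / R ^ 2 - 2 * g * V / R ^ 2"
    unfolding nu cc using rho_pos by simp
  also have "\<dots> = s ^ 2 * ?F + g * (2 * ?F * (1 - Q) + (- 2 * (?X + ?Y) / R ^ 2) * \<mu> + (- 2 / R ^ 2) * V)"
    unfolding \<rho>_def using R by (simp add: field_simps)
  finally have "K * (\<rho> * \<phi> a b (Suc i) x y) \<le> K * (s ^ 2 * ?F + g * (2 * ?F * (1 - Q) + (- 2 * (?X + ?Y) / R ^ 2) * \<mu> + (- 2 / R ^ 2) * V))"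
    using K by (rule mult_left_mono)
  also have "\<dots> = s ^ 2 * (K * ?F) + g * (2 * K * ?F * (1 - Q) + (- 2 * K * (?X + ?Y) / R ^ 2) * \<mu> + (- 2 * K / R ^ 2) * V)"
    by (simp add: algebra_simps)
  also have "\<dots> \<le> s ^ 2 * u i x y + g * ?E (\<lambda>z. (u i (x + z) y + u i x (y + z)) * indicator small z)"
    by (intro add_mono mult_left_mono le sm) (auto simp: g_nonneg)
  finally have "K * \<rho> * \<phi> a b (Suc i) x y + g * big_part i x y \<le>
     s ^ 2 * u i x y + g * ?E (\<lambda>z. u i (x + z) y + u i x (y + z))"
    unfolding sp by (simp add: distrib_left mult.assoc)
  also have "\<dots> \<le> u (Suc i) x y" using step[OF xy] by (simp add: g_def)
  finally show ?thesis .
qed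

text \<open>The assumptions place the disc around \<open>(a, b)\<close> inside the quadrant where
  \<open>u 0\<close> is 1. Outside the disc \<open>\<phi>\<close> is nonpositive, so the comparison
  holds at time 0 and \<open>step_lower\<close> propagates it.\<close>

lemma no_big_jump:
  assumes a: "R \<le> a" and b: "b \<le> - R"
  shows "\<rho> ^ i * \<phi> a b i x y \<le> u i x y"
proof (induction i arbitrary: x y)
  case 0
  show ?case
  proof (cases "0 < x \<and> y \<le> 0")
    case True
    then show ?thesis using base phi_le_1[of a b 0 x y] by simp
  next
    case False
    have "R ^ 2 \<le> (real_of_int x - a) ^ 2 + (real_of_int y - b) ^ 2"
    proof (cases "0 < x")
      case True
      with False have "R \<le> real_of_int y - b" using b by simp
      then have "R ^ 2 \<le> (real_of_int y - b) ^ 2" using R by (intro power_mono) auto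
      then show ?thesis by (simp add: add_increasing)
    next
      case False
      then have "R \<le> a - real_of_int x" using a by simp
      then have "R ^ 2 \<le> (a - real_of_int x) ^ 2" using R by (intro power_mono) auto
      also have "\<dots> = (real_of_int x - a) ^ 2" by (rule power2_commute)
      finally show ?thesis by (simp add: add_increasing2)
    qed
    then have "\<phi> a b 0 x y \<le> 0" by (intro phi_nonpos) simp
    then show ?thesis using u0[of 0 x y] by simp
  qed
next
  case (Suc i)
  have ab: "2 * R \<le> \<bar>a - b\<bar>" using a b by simp
  show ?case
  proof (cases "x = y")
    case True
    have "\<rho> ^ Suc i * \<phi> a b (Suc i) x y \<le> 0"
      using phi_diag[OF ab] rho_pos unfolding True by (intro mult_nonneg_nonpos) auto
    then show ?thesis using u0[of "Suc i" x y] by simp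
  next
    case False
    have "\<rho> ^ i * \<rho> * \<phi> a b (Suc i) x y + g * big_part i x y \<le> u (Suc i) x y"
      using rho_pos by (intro step_lower[OF False] Suc) auto
    moreover have "0 \<le> g * big_part i x y" using g_nonneg big_part_nonneg by simp
    ultimately show ?thesis by (simp add: mult.commute)
  qed
qed

text \<open>A discrete Duhamel formula: the coefficient accumulated so far is carried along by the
  small jumps, and each step gains another \<open>g * \<beta>\<close> from a big jump made in that
  step. The bound on \<open>big_part\<close> is requested within
  \<open>R + \<bar>\<nu>\<bar>\<close> of the centres because it is taken one step before
  \<open>\<phi>\<close>, when the centres differ by \<open>\<nu>\<close>.\<close>

lemma one_big_jump:
  assumes ab: "2 * R \<le> \<bar>a - b\<bar>" and \<beta>: "0 \<le> \<beta>"
    and big: "\<And>i x y. i < N \<Longrightarrow> \<bar>real_of_int x + real i * \<nu> - a\<bar> \<le> R + \<bar>\<nu>\<bar> \<Longrightarrow>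
      \<bar>real_of_int y + real i * \<nu> - b\<bar> \<le> R + \<bar>\<nu>\<bar> \<Longrightarrow> \<beta> \<le> big_part i x y"
  shows "i \<le> N \<Longrightarrow> \<rho> ^ i * real i * (g * \<beta>) * \<phi> a b i x y \<le> u i x y"
proof (induction i arbitrary: x y)
  case 0
  then show ?case using u0 by simp
next
  case (Suc i)
  have C: "0 \<le> \<rho> ^ Suc i * real (Suc i) * (g * \<beta>)" using rho_pos g_nonneg \<beta> by simp
  show ?case
  proof (cases "\<phi> a b (Suc i) x y \<le> 0")
    case True
    then have "\<rho> ^ Suc i * real (Suc i) * (g * \<beta>) * \<phi> a b (Suc i) x y \<le> 0"
      using C by (rule mult_nonneg_nonpos[rotated])
    then show ?thesis using u0[of "Suc i" x y] by simp
  next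
    case False
    let ?X = "real_of_int x + real (Suc i) * \<nu> - a" and ?Y = "real_of_int y + real (Suc i) * \<nu> - b"
    have xy: "x \<noteq> y" using False phi_diag[OF ab] by auto
    have "\<not> R ^ 2 \<le> ?X ^ 2 + ?Y ^ 2" using False phi_nonpos by blast
    then have "?X ^ 2 \<le> R ^ 2" "?Y ^ 2 \<le> R ^ 2"
      using zero_le_power2[of ?X] zero_le_power2[of ?Y] by linarith+
    then have "\<bar>?X\<bar> \<le> R" "\<bar>?Y\<bar> \<le> R" using R by (simp_all add: abs_le_square_iff[symmetric])
    then have "\<beta> \<le> big_part i x y"
      using Suc.prems by (intro big) (auto simp: distrib_right)
    then have B: "g * \<beta> \<le> g * big_part i x y" using g_nonneg by (rule mult_left_mono)
    \<comment> \<open>Hence the surplus \<open>g * \<beta>\<close> pays for raising the factor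
      \<open>i\<close> to \<open>Suc i\<close>.\<close>
    have "\<rho> ^ Suc i * \<phi> a b (Suc i) x y \<le> 1 * 1"
      using False rho_pos rho_le_1 phi_le_1 by (intro mult_mono power_le_one) auto
    then have "(\<rho> ^ Suc i * \<phi> a b (Suc i) x y) * (g * \<beta>) \<le> 1 * (g * \<beta>)"
      using g_nonneg \<beta> by (intro mult_right_mono) auto
    moreover have "\<rho> ^ i * real i * (g * \<beta>) * \<rho> * \<phi> a b (Suc i) x y + g * big_part i x y \<le> u (Suc i) x y"
      using rho_pos g_nonneg \<beta> Suc.prems by (intro step_lower[OF xy] Suc.IH) auto
    moreover have "\<rho> ^ Suc i * real (Suc i) * (g * \<beta>) * \<phi> a b (Suc i) x y =
      \<rho> ^ i * real i * (g * \<beta>) * \<rho> * \<phi> a b (Suc i) x y + (\<rho> ^ Suc i * \<phi> a b (Suc i) x y) * (g * \<beta>)"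
      by (simp add: algebra_simps)
    ultimately show ?thesis using B by linarith
  qed
qed

text \<open>The paraboloid is centred at the drift-corrected position itself, where only the term
  \<open>c * real i\<close> is lost.\<close>

lemma after_big_jump:
  assumes i: "i \<le> N" and x: "R \<le> real_of_int x + real i * \<nu>" and y: "real_of_int y + real i * \<nu> \<le> - R"
    and cN: "c * real N \<le> 1"
  shows "\<rho> ^ N * (1 - c * real N) \<le> u i x y"
proof -
  have "\<rho> ^ N * (1 - c * real N) \<le> \<rho> ^ i * (1 - c * real i)"
    using i rho_pos rho_le_1 c_nonneg cN
    by (intro mult_mono power_decreasing diff_left_mono mult_left_mono) auto
  also have "\<dots> = \<rho> ^ i * \<phi> (real_of_int x + real i * \<nu>) (real_of_int y + real i * \<nu>) i x y"
    by (simp add: \<phi>_def)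
  also have "\<dots> \<le> u i x y" by (rule no_big_jump[OF x y])
  finally show ?thesis .
qed

lemma big_part_right:
  assumes "\<And>z. n \<le> z \<Longrightarrow> \<kappa> \<le> u i (x + z) y" "0 \<le> \<kappa>"
  shows "\<kappa> * measure_pmf.prob p {z. n \<le> z} \<le> big_part i x y"
proof -
  have "\<kappa> * measure_pmf.prob p {z. n \<le> z} = measure_pmf.expectation p (\<lambda>z. \<kappa> * indicator {z. n \<le> z} z)"
    by simp
  also have "\<dots> \<le> big_part i x y"
    unfolding big_part_def
  proof (rule integral_mono)
    show "integrable (measure_pmf p) (\<lambda>z. \<kappa> * indicator {z. n \<le> z} z)"
      by (intro measure_pmf.integrable_const_bound[where B="\<bar>\<kappa>\<bar>"]) (auto simp: indicator_def)
    show "\<kappa> * indicator {z. n \<le> z} z \<le> (u i (x + z) y + u i x (y + z)) * indicator (- small) z" for z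
      using assms(1)[of z] u0[of i x "y + z"] u0[of i "x + z" y] n_pos by (auto simp: indicator_def small_def)
  qed (rule integrable_u)
  finally show ?thesis .
qed

lemma big_part_left:
  assumes "\<And>z. z \<le> - n \<Longrightarrow> \<kappa> \<le> u i x (y + z)" "0 \<le> \<kappa>"
  shows "\<kappa> * measure_pmf.prob p {z. z \<le> - n} \<le> big_part i x y"
proof -
  have "\<kappa> * measure_pmf.prob p {z. z \<le> - n} = measure_pmf.expectation p (\<lambda>z. \<kappa> * indicator {z. z \<le> - n} z)"
    by simp
  also have "\<dots> \<le> big_part i x y"
    unfolding big_part_def
  proof (rule integral_mono)
    show "integrable (measure_pmf p) (\<lambda>z. \<kappa> * indicator {z. z \<le> - n} z)"
      by (intro measure_pmf.integrable_const_bound[where B="\<bar>\<kappa>\<bar>"]) (auto simp: indicator_def)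
    show "\<kappa> * indicator {z. z \<le> - n} z \<le> (u i (x + z) y + u i x (y + z)) * indicator (- small) z" for z
      using assms(1)[of z] u0[of i x "y + z"] u0[of i "x + z" y] n_pos by (auto simp: indicator_def small_def)
  qed (rule integrable_u)
  finally show ?thesis .
qed

text \<open>At least half of \<open>Q\<close> lies on one side. If it is the right, the first walk
  makes the big jump, otherwise the second. The factor \<open>\<kappa>\<close> is the bound for what
  happens after the jump, and the rest of the product bounds the evolution before it together with
  the jump.\<close>

lemma crossing:
  assumes nR: "8 * R \<le> real_of_int n" and nu: "\<bar>\<nu>\<bar> \<le> R" and cN: "c * real N \<le> 1"
  shows "\<exists>x y. real_of_int n - 6 * R \<le> real_of_int (y - x) \<and>
     \<rho> ^ N * real N * (g * (\<rho> ^ N * (1 - c * real N) * (Q / 2))) * (1 - 2 / R ^ 2 - c * real N) \<le> u N x y"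
proof -
  define \<kappa> where "\<kappa> = \<rho> ^ N * (1 - c * real N)"
  have \<kappa>: "0 \<le> \<kappa>" unfolding \<kappa>_def using rho_pos cN by simp
  have \<beta>: "0 \<le> \<kappa> * (Q / 2)" using \<kappa> Q_range by simp
  have fin: "\<exists>x y. real_of_int n - 6 * R \<le> real_of_int (y - x) \<and>
      \<rho> ^ N * real N * (g * (\<kappa> * (Q / 2))) * (1 - 2 / R ^ 2 - c * real N) \<le> u N x y"
    if ba: "b - a = real_of_int n - 6 * R"
      and big: "\<And>i x y. i < N \<Longrightarrow> \<bar>real_of_int x + real i * \<nu> - a\<bar> \<le> R + \<bar>\<nu>\<bar> \<Longrightarrow>
      \<bar>real_of_int y + real i * \<nu> - b\<bar> \<le> R + \<bar>\<nu>\<bar> \<Longrightarrow> \<kappa> * (Q / 2) \<le> big_part i x y" for a b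
  proof -
    \<comment> \<open>Rounding outwards does not shorten the distance \<open>b - a\<close>. Either
      coordinate is moved by at most 1, which costs \<open>2 / R ^ 2\<close>.\<close>
    define x where "x = \<lfloor>a - real N * \<nu>\<rfloor>"
    define y where "y = \<lceil>b - real N * \<nu>\<rceil>"
    have x: "real_of_int x \<le> a - real N * \<nu>" "a - real N * \<nu> < real_of_int x + 1"
      unfolding x_def by linarith+
    have y: "b - real N * \<nu> \<le> real_of_int y" "real_of_int y < b - real N * \<nu> + 1"
      unfolding y_def by linarith+
    have "(real_of_int x + real N * \<nu> - a) ^ 2 \<le> 1" "(real_of_int y + real N * \<nu> - b) ^ 2 \<le> 1"
      using x y by (auto simp: abs_square_le_1)
    then have "((real_of_int x + real N * \<nu> - a) ^ 2 + (real_of_int y + real N * \<nu> - b) ^ 2) / R ^ 2 \<le> 2 / R ^ 2"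
      using R by (intro divide_right_mono) auto
    then have "1 - 2 / R ^ 2 - c * real N \<le> \<phi> a b N x y" unfolding \<phi>_def by linarith
    then have "\<rho> ^ N * real N * (g * (\<kappa> * (Q / 2))) * (1 - 2 / R ^ 2 - c * real N) \<le>
       \<rho> ^ N * real N * (g * (\<kappa> * (Q / 2))) * \<phi> a b N x y"
      using rho_pos g_nonneg \<beta> by (intro mult_left_mono) auto
    also have "\<dots> \<le> u N x y"
    proof (rule one_big_jump[OF _ \<beta> big order.refl])
      show "2 * R \<le> \<bar>a - b\<bar>" using ba nR R by linarith
    qed
    finally show ?thesis using x y ba by (intro exI[of _ x] exI[of _ y]) auto
  qed
  have "{z. n \<le> \<bar>z\<bar>} = {z. n \<le> z} \<union> {z. z \<le> - n}" by auto
  then have "Q \<le> measure_pmf.prob p {z. n \<le> z} + measure_pmf.prob p {z. z \<le> - n}"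
    unfolding Q_def by (simp add: measure_Un_le)
  then consider "Q / 2 \<le> measure_pmf.prob p {z. n \<le> z}" | "Q / 2 \<le> measure_pmf.prob p {z. z \<le> - n}"
    by linarith
  then show ?thesis unfolding \<kappa>_def[symmetric]
  proof cases
    case 1
    show "\<exists>x y. real_of_int n - 6 * R \<le> real_of_int (y - x) \<and>
      \<rho> ^ N * real N * (g * (\<kappa> * (Q / 2))) * (1 - 2 / R ^ 2 - c * real N) \<le> u N x y"
    \<comment> \<open>The second walk is within \<open>2 * R\<close> of \<open>- 3 * R\<close>,
      hence at most \<open>- R\<close>. The first is within \<open>2 * R\<close> of
      \<open>3 * R - n\<close>, and a jump of at least \<open>n\<close> takes it to \<open>R\<close>
      or beyond. Positions are corrected by the drift.\<close>
    proof (rule fin[of "- 3 * R" "3 * R - real_of_int n"])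
      fix i x y
      assume i: "i < N" and x: "\<bar>real_of_int x + real i * \<nu> - (3 * R - real_of_int n)\<bar> \<le> R + \<bar>\<nu>\<bar>"
        and y: "\<bar>real_of_int y + real i * \<nu> - (- 3 * R)\<bar> \<le> R + \<bar>\<nu>\<bar>"
      have "\<kappa> * (Q / 2) \<le> \<kappa> * measure_pmf.prob p {z. n \<le> z}" using 1 \<kappa> by (rule mult_left_mono)
      also have "\<dots> \<le> big_part i x y"
      proof (rule big_part_right[OF _ \<kappa>])
        fix z assume z: "n \<le> z"
        then have "real_of_int n \<le> real_of_int z" by simp
        then show "\<kappa> \<le> u i (x + z) y"
          unfolding \<kappa>_def using i x y nu cN by (intro after_big_jump) auto
      qed
      finally show "\<kappa> * (Q / 2) \<le> big_part i x y" .
    qed simp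
  next
    case 2
    show "\<exists>x y. real_of_int n - 6 * R \<le> real_of_int (y - x) \<and>
      \<rho> ^ N * real N * (g * (\<kappa> * (Q / 2))) * (1 - 2 / R ^ 2 - c * real N) \<le> u N x y"
    \<comment> \<open>The mirror image: the first walk is already at least \<open>R\<close>, and the
      second is thrown from near \<open>n - 3 * R\<close> to at most \<open>- R\<close>.\<close>
    proof (rule fin[of "real_of_int n - 3 * R" "3 * R"])
      fix i x y
      assume i: "i < N" and x: "\<bar>real_of_int x + real i * \<nu> - 3 * R\<bar> \<le> R + \<bar>\<nu>\<bar>"
        and y: "\<bar>real_of_int y + real i * \<nu> - (real_of_int n - 3 * R)\<bar> \<le> R + \<bar>\<nu>\<bar>"
      have "\<kappa> * (Q / 2) \<le> \<kappa> * measure_pmf.prob p {z. z \<le> - n}" using 2 \<kappa> by (rule mult_left_mono)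
      also have "\<dots> \<le> big_part i x y"
      proof (rule big_part_left[OF _ \<kappa>])
        fix z assume z: "z \<le> - n"
        then have "real_of_int z \<le> - real_of_int n" by simp
        then show "\<kappa> \<le> u i x (y + z)"
          unfolding \<kappa>_def using i x y nu cN by (intro after_big_jump) auto
      qed
      finally show "\<kappa> * (Q / 2) \<le> big_part i x y" .
    qed simp
  qed
qed

lemma abs_mu_le: "\<bar>\<mu>\<bar> \<le> real_of_int n"
proof -
  have "\<bar>\<mu>\<bar> \<le> measure_pmf.expectation p (\<lambda>z. \<bar>real_of_int z * indicator small z\<bar>)"
    unfolding \<mu>_def by (rule integral_abs_bound)
  also have "\<dots> \<le> measure_pmf.expectation p (\<lambda>z. real_of_int n)"
    using integrable_id_small n_pos by (intro integral_mono) (auto simp: small_def indicator_def)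
  finally show ?thesis by (simp add: measure_pmf.prob_space[simplified])
qed

end

section \<open>Scales with many big jumps\<close>

lemma expectation_finite_support:
  fixes f :: "int \<Rightarrow> real"
  shows "measure_pmf.expectation p (\<lambda>z. f z * indicator {z. \<bar>z\<bar> < m} z) = (\<Sum>z\<in>{- m<..<m}. f z * pmf p z)"
proof -
  have "measure_pmf.expectation p (\<lambda>z. f z * indicator {z. \<bar>z\<bar> < m} z) =
     (\<Sum>z\<in>{- m<..<m}. pmf p z *\<^sub>R (f z * indicator {z. \<bar>z\<bar> < m} z))"
    by (rule integral_measure_pmf) (auto simp: indicator_def abs_less_iff split: if_splits)
  also have "\<dots> = (\<Sum>z\<in>{- m<..<m}. f z * pmf p z)"
    by (intro sum.cong) (auto simp: indicator_def abs_less_iff)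
  finally show ?thesis .
qed

text \<open>If the claim fails from \<open>n0\<close> on, doubling \<open>n\<close> multiplies the
  truncated second moment by at most \<open>r = 1 + 4 / C\<close>, as the new shell adds at most
  \<open>4 * n ^ 2\<close> times the tail. The share of a shell in the moment of order
  \<open>c\<close> is at most \<open>n powr (c - 2)\<close> times that second moment. Along dyadic
  scales these bounds form a geometric series of ratio \<open>r * \<theta>\<close>.\<close>

lemma heavy_scale:
  assumes c2: "c < 2" and heavy: "\<not> (\<lambda>x. \<bar>real_of_int x\<bar> powr c * pmf p x) summable_on UNIV"
  shows "\<exists>C\<ge>1. \<forall>m. \<exists>n\<ge>m. 0 < n \<and> 0 < measure_pmf.prob p {z. n \<le> \<bar>z\<bar>} \<and>
    (\<Sum>z\<in>{- n<..<n}. real_of_int z ^ 2 * pmf p z) \<le> C * real_of_int n ^ 2 * measure_pmf.prob p {z. n \<le> \<bar>z\<bar>}"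
proof -
  define \<theta> :: real where "\<theta> = 2 powr (c - 2)"
  have \<theta>: "0 < \<theta>" "\<theta> < 1" using c2 by (auto simp: \<theta>_def powr_less_one)
  \<comment> \<open>\<open>r * \<theta> < 1\<close> amounts to
    \<open>4 * \<theta> < C * (1 - \<theta>)\<close>; the summand 1 makes this strict.\<close>
  define C where "C = 1 + 4 * \<theta> / (1 - \<theta>)"
  have C1: "1 \<le> C" unfolding C_def using \<theta> by simp
  define r where "r = 1 + 4 / C"
  have r1: "1 \<le> r" using C1 by (simp add: r_def)
  have "C * (1 - \<theta>) = (1 - \<theta>) + 4 * \<theta>" unfolding C_def using \<theta> by (simp add: distrib_right)
  then have "4 * \<theta> < C * (1 - \<theta>)" using \<theta> by linarith
  then have r\<theta>: "r * \<theta> < 1" unfolding r_def using C1 by (simp add: field_simps)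
  let ?V = "\<lambda>n. \<Sum>z\<in>{- n<..<n}. real_of_int z ^ 2 * pmf p z"
  let ?A = "\<lambda>n. \<Sum>z\<in>{- n<..<n}. \<bar>real_of_int z\<bar> powr c * pmf p z"
  let ?Q = "\<lambda>n. measure_pmf.prob p {z. n \<le> \<bar>z\<bar>}"
  have V0: "0 \<le> ?V n" for n by (intro sum_nonneg) auto
  show ?thesis
  proof (rule ccontr)
    assume "\<not> ?thesis"
    then have "\<not> (\<forall>m. \<exists>n\<ge>m. 0 < n \<and> 0 < ?Q n \<and> ?V n \<le> C * real_of_int n ^ 2 * ?Q n)"
      using C1 by blast
    then obtain m where m: "\<And>n. n \<ge> m \<Longrightarrow> \<not> (0 < n \<and> 0 < ?Q n \<and> ?V n \<le> C * real_of_int n ^ 2 * ?Q n)"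
      by blast
    define n0 where "n0 = max m 1"
    have n0: "m \<le> n0" "1 \<le> n0" by (auto simp: n0_def)
    \<comment> \<open>Failure of the claim may also mean that the tail vanishes; the left side is
      then 0.\<close>
    have Q: "real_of_int n ^ 2 * ?Q n \<le> ?V n / C" if "n0 \<le> n" for n
    proof (cases "0 < ?Q n")
      case True
      then have "C * real_of_int n ^ 2 * ?Q n < ?V n" using m[of n] that n0 by linarith
      then show ?thesis using C1 by (simp add: field_simps)
    next
      case False
      then have "?Q n = 0" using measure_nonneg[of "measure_pmf p" "{z. n \<le> \<bar>z\<bar>}"] by linarith
      then show ?thesis using V0[of n] C1 by simp
    qed
    have split: "(\<Sum>z\<in>{- (2 * n)<..<2 * n}. f z) = (\<Sum>z\<in>{- n<..<n}. f z) + (\<Sum>z\<in>{- (2 * n)<..<2 * n} - {- n<..<n}. f z)"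
      if "n0 \<le> n" for n and f :: "int \<Rightarrow> real"
      using that n0 by (subst sum.subset_diff[of "{- n<..<n}" "{- (2 * n)<..<2 * n}"]) auto
    have V2: "?V (2 * n) \<le> r * ?V n" if n: "n0 \<le> n" for n
    proof -
      have "(\<Sum>z\<in>{- (2 * n)<..<2 * n} - {- n<..<n}. real_of_int z ^ 2 * pmf p z) \<le>
        (\<Sum>z\<in>{- (2 * n)<..<2 * n} - {- n<..<n}. (2 * real_of_int n) ^ 2 * pmf p z)"
      proof (intro sum_mono mult_right_mono)
        fix z assume "z \<in> {- (2 * n)<..<2 * n} - {- n<..<n}"
        then have "\<bar>z\<bar> \<le> 2 * n" by auto
        then have "\<bar>real_of_int z\<bar> \<le> \<bar>2 * real_of_int n\<bar>" using n n0 by linarith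
        then show "real_of_int z ^ 2 \<le> (2 * real_of_int n) ^ 2" by (simp only: abs_le_square_iff)
      qed simp
      also have "\<dots> = (2 * real_of_int n) ^ 2 * measure_pmf.prob p ({- (2 * n)<..<2 * n} - {- n<..<n})"
        by (simp add: measure_measure_pmf_finite sum_distrib_left)
      also have "\<dots> \<le> (2 * real_of_int n) ^ 2 * ?Q n"
        by (intro mult_left_mono measure_pmf.finite_measure_mono) auto
      also have "\<dots> = 4 * (real_of_int n ^ 2 * ?Q n)" by (simp add: power_mult_distrib)
      also have "\<dots> \<le> 4 * (?V n / C)" using Q[OF n] by simp
      finally show ?thesis unfolding split[OF n] r_def by (simp add: algebra_simps)
    qed
    define N where "N k = n0 * 2 ^ k" for k :: nat
    have N: "n0 \<le> N k" for k unfolding N_def using n0 by simp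
    have NS: "N (Suc k) = 2 * N k" for k by (simp add: N_def)
    have Vk: "?V (N k) \<le> ?V n0 * r ^ k" for k
    proof (induction k)
      case (Suc k)
      have "?V (N (Suc k)) \<le> r * ?V (N k)" unfolding NS by (rule V2[OF N])
      also have "\<dots> \<le> r * (?V n0 * r ^ k)" using Suc r1 by (intro mult_left_mono) auto
      finally show ?case by (simp add: ac_simps)
    qed (simp add: N_def)
    have shell: "(\<Sum>z\<in>{- (2 * n)<..<2 * n} - {- n<..<n}. \<bar>real_of_int z\<bar> powr c * pmf p z) \<le> real_of_int n powr (c - 2) * ?V (2 * n)"
      if n: "n0 \<le> n" for n
    proof -
      have "(\<Sum>z\<in>{- (2 * n)<..<2 * n} - {- n<..<n}. \<bar>real_of_int z\<bar> powr c * pmf p z) \<le>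
         (\<Sum>z\<in>{- (2 * n)<..<2 * n} - {- n<..<n}. real_of_int n powr (c - 2) * (real_of_int z ^ 2 * pmf p z))"
      proof (intro sum_mono)
        fix z assume "z \<in> {- (2 * n)<..<2 * n} - {- n<..<n}"
        then have z: "n \<le> \<bar>z\<bar>" "0 < \<bar>z\<bar>" using n n0 by auto
        then have "\<bar>real_of_int z\<bar> powr c = \<bar>real_of_int z\<bar> powr (c - 2) * \<bar>real_of_int z\<bar> powr 2"
          by (subst powr_add[symmetric]) simp
        also have "\<bar>real_of_int z\<bar> powr 2 = real_of_int z ^ 2" using z by (simp add: powr_numeral)
        also have "\<bar>real_of_int z\<bar> powr (c - 2) \<le> real_of_int n powr (c - 2)"
          using z n n0 c2 by (intro powr_mono2') auto
        finally have "\<bar>real_of_int z\<bar> powr c \<le> real_of_int n powr (c - 2) * real_of_int z ^ 2"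
          by (simp add: mult_right_mono)
        then show "\<bar>real_of_int z\<bar> powr c * pmf p z \<le> real_of_int n powr (c - 2) * (real_of_int z ^ 2 * pmf p z)"
          using mult_right_mono[of _ _ "pmf p z"] by (simp add: mult.assoc[symmetric])
      qed
      also have "\<dots> = real_of_int n powr (c - 2) * (\<Sum>z\<in>{- (2 * n)<..<2 * n} - {- n<..<n}. real_of_int z ^ 2 * pmf p z)"
        by (simp add: sum_distrib_left)
      also have "\<dots> \<le> real_of_int n powr (c - 2) * ?V (2 * n)"
        unfolding split[OF n] using V0[of n] by (intro mult_left_mono) auto
      finally show ?thesis .
    qed
    define D where "D = real_of_int n0 powr (c - 2) * (?V n0 * r)"
    have D0: "0 \<le> D" unfolding D_def using V0 r1 by simp
    have Ak: "?A (N k) \<le> ?A n0 + D * (\<Sum>j<k. (r * \<theta>) ^ j)" for k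
    proof (induction k)
      case (Suc k)
      have "real_of_int (N k) powr (c - 2) = real_of_int n0 powr (c - 2) * \<theta> ^ k"
        unfolding N_def \<theta>_def using n0 by (simp add: powr_mult powr_realpow[symmetric] powr_powr powr_power mult.commute)
      then have "real_of_int (N k) powr (c - 2) * ?V (2 * N k) \<le> (real_of_int n0 powr (c - 2) * \<theta> ^ k) * (?V n0 * r ^ Suc k)"
        using Vk[of "Suc k"] \<theta> unfolding NS by (intro mult_mono) (auto intro: V0)
      also have "\<dots> = D * (r * \<theta>) ^ k" by (simp add: D_def power_mult_distrib)
      finally have "(\<Sum>z\<in>{- (2 * N k)<..<2 * N k} - {- N k<..<N k}. \<bar>real_of_int z\<bar> powr c * pmf p z) \<le> D * (r * \<theta>) ^ k"
        using shell[OF N, of k] by linarith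
      then have "?A (N (Suc k)) \<le> ?A (N k) + D * (r * \<theta>) ^ k"
        unfolding NS split[OF N] by simp
      then show ?case using Suc by (simp add: distrib_left)
    qed (simp add: N_def)
    have bound: "(\<Sum>z\<in>F. \<bar>real_of_int z\<bar> powr c * pmf p z) \<le> ?A n0 + D * (1 / (1 - r * \<theta>))" if F: "finite F" for F
    proof -
      obtain b where b: "\<And>z. z \<in> F \<Longrightarrow> \<bar>z\<bar> \<le> b"
        using F by (metis (no_types, lifting) finite_imageI Max_ge imageI)
      define k where "k = nat b + 1"
      have "b < int k" by (simp add: k_def)
      also have "int k < 2 ^ k" by (metis of_nat_less_two_power)
      also have "\<dots> \<le> N k" unfolding N_def using n0 by simp
      finally have "F \<subseteq> {- N k<..<N k}" using b by force
      then have "(\<Sum>z\<in>F. \<bar>real_of_int z\<bar> powr c * pmf p z) \<le> ?A (N k)" by (intro sum_mono2) auto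
      also have "\<dots> \<le> ?A n0 + D * (\<Sum>j<k. (r * \<theta>) ^ j)" by (rule Ak)
      also have "(\<Sum>j<k. (r * \<theta>) ^ j) \<le> 1 / (1 - r * \<theta>)"
        using r\<theta> r1 \<theta> by (simp add: sum_gp_strict divide_right_mono)
      then have "?A n0 + D * (\<Sum>j<k. (r * \<theta>) ^ j) \<le> ?A n0 + D * (1 / (1 - r * \<theta>))"
        using D0 by (intro add_left_mono mult_left_mono) auto
      finally show ?thesis .
    qed
    have "(\<lambda>x. \<bar>real_of_int x\<bar> powr c * pmf p x) summable_on UNIV"
      by (rule nonneg_bdd_above_summable_on)
        (auto intro!: bdd_aboveI[where M="?A n0 + D * (1 / (1 - r * \<theta>))"] bound)
    then show False using heavy by contradiction
  qed
qed

text \<open>At time \<open>t\<close> the expected number of big jumps of one walk is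
  \<open>\<tau>\<close>, and the bound obtained is of first order in \<open>\<tau>\<close>. It
  depends on \<open>C\<close> alone, while the distance grows with \<open>n\<close>.\<close>

lemma crossing_probability:
  fixes C \<tau> :: real
  assumes C: "1 \<le> C" and \<tau>: "\<tau> = 1 / (4096 * C)" and n: "64 \<le> n"
    and Q: "0 < measure_pmf.prob p {z. n \<le> \<bar>z\<bar>}"
    and V: "(\<Sum>z\<in>{- n<..<n}. real_of_int z ^ 2 * pmf p z) \<le> C * real_of_int n ^ 2 * measure_pmf.prob p {z. n \<le> \<bar>z\<bar>}"
    and t: "t = \<tau> / measure_pmf.prob p {z. n \<le> \<bar>z\<bar>}"
  shows "\<exists>x y. real_of_int n / 2 \<le> real_of_int (y - x) \<and> \<tau> / 64 \<le> two_prob p {0<..} {..0} t x y"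
proof -
  let ?q = "measure_pmf.prob p {z. n \<le> \<bar>z\<bar>}"
  have \<tau>0: "0 < \<tau>" "\<tau> \<le> 1 / 4096" "\<tau> * C = 1 / 4096" unfolding \<tau> using C by (auto simp: field_simps)
  have t0: "0 < t" "t * ?q = \<tau>" using \<tau>0 Q unfolding t by auto
  \<comment> \<open>Errors of order \<open>h ^ 2\<close> in each step add up to order
    \<open>h * t\<close>. This \<open>N\<close> makes both \<open>h\<close> and \<open>h * t\<close>
    at most 1/64.\<close>
  define N where "N = nat \<lceil>64 * (t + 1) ^ 2\<rceil>"
  have N: "64 * (t + 1) ^ 2 \<le> real N" unfolding N_def by linarith
  have "0 < 64 * (t + 1) ^ 2" using t0 by simp
  then have N0: "0 < real N" using N by linarith
  define h where "h = t / real N"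
  have h0: "0 < h" "real N * h = t" unfolding h_def using t0 N0 by auto
  have "h \<le> t / (64 * (t + 1) ^ 2)" unfolding h_def using N N0 t0 by (intro divide_left_mono mult_pos_pos) auto
  also have "\<dots> \<le> (t + 1) / (64 * (t + 1) ^ 2)" using t0 by (intro divide_right_mono) auto
  also have "\<dots> = 1 / (64 * (t + 1))" using t0 by (simp add: power2_eq_square)
  finally have h1: "h \<le> 1 / (64 * (t + 1))" .
  then have ht: "64 * h * (t + 1) \<le> 1" using t0 by (simp add: field_simps)
  have h2: "h \<le> 1 / 64"
  proof -
    have "h * 1 \<le> h * (t + 1)" using h0 t0 by (intro mult_left_mono) auto
    then show ?thesis using ht by simp
  qed
  have ht2: "h * t \<le> 1 / 64"
  proof -
    have "h * t \<le> h * (t + 1)" using h0 by simp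
    then show ?thesis using ht by simp
  qed
  define s where "s = exp (- h)"
  have s01: "0 < s" "s < 1" using h0 by (auto simp: s_def)
  \<comment> \<open>The distance \<open>n - 6 * R\<close> then exceeds \<open>n / 2\<close>, and
    \<open>n \<ge> 64\<close> keeps the rounding loss \<open>2 / R ^ 2\<close> below 1/4.\<close>
  define R where "R = real_of_int n / 16"
  have R4: "4 \<le> R" using n by (simp add: R_def)
  define u where "u i x y = two_prob p {0<..} {..0} (real i * h) x y" for i x y
  interpret two_walk p n s R u
  proof
    show "0 < n" "0 < s" "s < 1" "0 < R" using n s01 R4 by auto
    show "0 \<le> u i x y" "u i x y \<le> 1" for i x y by (auto simp: u_def two_prob_range)
    show "u 0 x y = 1" if "0 < x" "y \<le> 0" for x y using that by (simp add: u_def two_prob_zero)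
    show "s ^ 2 * u i x y + s ^ 3 * (1 - s) * measure_pmf.expectation p (\<lambda>z. u i (x + z) y + u i x (y + z)) \<le> u (Suc i) x y"
      if "x \<noteq> y" for i x y
    proof -
      have "{0<..} \<inter> {..0::int} = {}" by auto
      from two_prob_step[OF _ _ this that, of "real i * h" h p] show ?thesis
        using h0 by (simp add: u_def s_def distrib_right add.commute)
    qed
  qed
  have Qq: "Q = ?q" by (simp add: Q_def)
  have VC: "V \<le> C * real_of_int n ^ 2 * ?q"
    using V by (simp add: V_def small_def expectation_finite_support)
  have s1: "1 - h \<le> s" unfolding s_def using exp_ge_add_one_self[of "- h"] by simp
  have s2: "h - h ^ 2 \<le> 1 - s"
  proof -
    have "1 + h \<le> exp h" by (rule exp_ge_add_one_self)
    then have "s \<le> 1 / (1 + h)" unfolding s_def exp_minus inverse_eq_divide using h0 by (intro divide_left_mono) auto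
    also have "\<dots> \<le> 1 - h + h ^ 2" using h0 by (simp add: field_simps power2_eq_square power3_eq_cube)
    finally show ?thesis by simp
  qed
  have gh: "g \<le> h"
  proof -
    have "g \<le> 1 * (1 - s)" unfolding g_def using s01 by (intro mult_right_mono) (auto simp: power_le_one)
    then show ?thesis using s1 by simp
  qed
  have gh': "h - 4 * h ^ 2 \<le> g"
  proof -
    have "1 + real 3 * (- h) \<le> (1 + - h) ^ 3" using h2 by (intro Bernoulli_inequality) auto
    also have "\<dots> \<le> s ^ 3" using s1 h2 by (intro power_mono) auto
    finally have s3: "1 - 3 * h \<le> s ^ 3" by simp
    have "h - 4 * h ^ 2 \<le> (1 - 3 * h) * (h - h ^ 2)" using h0 by (simp add: algebra_simps power2_eq_square)
    also have "\<dots> \<le> s ^ 3 * (1 - s)" using s3 s2 h0 h2 s01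
      by (intro mult_mono) (auto simp: power2_eq_square mult_le_one)
    finally show ?thesis by (simp add: g_def)
  qed
  have \<rho>1: "1 - 2 * h * Q - 8 * h ^ 2 \<le> \<rho>"
  proof -
    have "(1 - h) ^ 2 \<le> s ^ 2" using s1 h2 by (intro power_mono) auto
    moreover have "(h - 4 * h ^ 2) * (1 - Q) \<le> g * (1 - Q)" using gh' Q_range by (intro mult_right_mono) auto
    moreover have "(1 - h) ^ 2 + 2 * ((h - 4 * h ^ 2) * (1 - Q)) = 1 - 2 * h * Q + h ^ 2 - 8 * h ^ 2 * (1 - Q)"
      by (simp add: algebra_simps power2_eq_square)
    moreover have "8 * h ^ 2 * (1 - Q) \<le> 8 * h ^ 2 * 1" using Q_range by (intro mult_left_mono) auto
    moreover have "0 \<le> h ^ 2" by simp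
    ultimately show ?thesis unfolding \<rho>_def by linarith
  qed
  have hh: "h ^ 2 \<le> h * (1 / 64)" unfolding power2_eq_square using h0 h2 by (intro mult_left_mono) auto
  have hQ: "h * Q \<le> h * 1" using Q_range h0 by (intro mult_left_mono) auto
  have \<rho>half: "1 / 2 \<le> \<rho>" using \<rho>1 hh hQ h2 by linarith
  have \<rho>N: "1 / 2 \<le> \<rho> ^ N"
  proof -
    \<comment> \<open>Bernoulli's inequality over \<open>N\<close> steps: killing at big jumps costs
      \<open>2 * \<tau>\<close>, the discretisation \<open>8 * (h * t)\<close>.\<close>
    have "1 / 2 \<le> 1 - 2 * \<tau> - 8 * (h * t)" using \<tau>0 ht2 by linarith
    also have "\<dots> = 1 + real N * (- (2 * h * Q + 8 * h ^ 2))"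
    proof -
      have "real N * (2 * h * Q + 8 * h ^ 2) = 2 * ((real N * h) * Q) + 8 * (h * (real N * h))"
        by (simp add: algebra_simps power2_eq_square)
      also have "\<dots> = 2 * \<tau> + 8 * (h * t)" unfolding h0(2) Qq t0(2) ..
      finally show ?thesis unfolding mult_minus_right by linarith
    qed
    also have "\<dots> \<le> (1 + - (2 * h * Q + 8 * h ^ 2)) ^ N"
      using hh hQ h2 by (intro Bernoulli_inequality) linarith
    also have "\<dots> \<le> \<rho> ^ N" using \<rho>1 hh hQ h2 by (intro power_mono) linarith+
    finally show ?thesis .
  qed
  \<comment> \<open>This fixes \<open>\<tau>\<close>: the left side is at most
    \<open>1024 * (\<tau> * C)\<close>, where 256 comes from \<open>R = n / 16\<close> and the
    remaining 4 from the factor 2 in \<open>c\<close> and \<open>\<rho> \<ge> 1 / 2\<close>.\<close>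
  have cN: "c * real N \<le> 1 / 4"
  proof -
    have "c * real N = 2 * (g * real N) * (V / R ^ 2) / \<rho>" unfolding c_def using R by (simp add: field_simps)
    also have "\<dots> \<le> 2 * (g * real N) * (V / R ^ 2) / (1 / 2)"
      using \<rho>half g_nonneg V_nonneg rho_pos by (intro divide_left_mono) auto
    also have "\<dots> = 4 * (g * real N) * (V / R ^ 2)" by simp
    also have "\<dots> \<le> 4 * t * (256 * (C * ?q))"
    proof (rule mult_mono)
      show "4 * (g * real N) \<le> 4 * t" using mult_right_mono[OF gh, of "real N"] h0(2) by (simp add: mult.commute)
      have "V / R ^ 2 \<le> C * real_of_int n ^ 2 * ?q / R ^ 2" using VC by (intro divide_right_mono) auto
      also have "\<dots> = 256 * (C * ?q)" unfolding R_def using n by (simp add: power2_eq_square)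
      finally show "V / R ^ 2 \<le> 256 * (C * ?q)" .
    qed (use t0 V_nonneg in auto)
    also have "\<dots> = 1024 * (\<tau> * C)" using t0(2) by (simp add: ac_simps)
    finally show ?thesis using \<tau>0 by simp
  qed
  \<comment> \<open>Only the drift of a single step must be small. Over the whole time it may far
    exceed \<open>n\<close>, but the centres move along with it.\<close>
  have nu: "\<bar>\<nu>\<bar> \<le> R"
  proof -
    have "\<bar>\<nu>\<bar> = g * \<bar>\<mu>\<bar> / \<rho>" unfolding \<nu>_def using g_nonneg rho_pos by (simp add: abs_mult)
    also have "\<dots> \<le> g * \<bar>\<mu>\<bar> / (1 / 2)"
      using \<rho>half g_nonneg rho_pos by (intro divide_left_mono) auto
    also have "\<dots> \<le> h * real_of_int n / (1 / 2)"
      using gh abs_mu_le g_nonneg h0 by (intro divide_right_mono mult_mono) auto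
    also have "\<dots> = real_of_int n * (2 * h)" by simp
    also have "\<dots> \<le> real_of_int n * (1 / 16)" using h2 n by (intro mult_left_mono) auto
    finally show ?thesis by (simp add: R_def)
  qed
  obtain x y where xy: "real_of_int n - 6 * R \<le> real_of_int (y - x)"
    "\<rho> ^ N * real N * (g * (\<rho> ^ N * (1 - c * real N) * (Q / 2))) * (1 - 2 / R ^ 2 - c * real N) \<le> u N x y"
    using crossing[of N] nu cN n by (auto simp: R_def)
  have R2: "2 / R ^ 2 \<le> 1 / 4"
  proof -
    have "4 ^ 2 \<le> R ^ 2" using R4 by (intro power_mono) auto
    then show ?thesis using R by (simp add: field_simps)
  qed
  have gN: "t / 2 \<le> real N * g"
  proof -
    have "t / 2 \<le> t * (1 - 4 * h)" using h2 t0 by (intro order.trans[OF _ mult_left_mono[of "1/2" "1 - 4 * h" t]]) auto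
    also have "\<dots> = real N * (h - 4 * h ^ 2)" unfolding h0(2)[symmetric] by (simp add: algebra_simps power2_eq_square)
    also have "\<dots> \<le> real N * g" using gh' by (intro mult_left_mono) auto
    finally show ?thesis .
  qed
  \<comment> \<open>The product on the right equals \<open>3 * \<tau> / 128\<close>.\<close>
  have "\<tau> / 64 \<le> (1 / 2) * (t / 2) * ((1 / 2) * (3 / 4) * (Q / 2)) * (1 / 2)"
    using t0(2) \<tau>0 unfolding Qq by (simp add: field_simps)
  also have "\<dots> \<le> \<rho> ^ N * (real N * g) * (\<rho> ^ N * (1 - c * real N) * (Q / 2)) * (1 - 2 / R ^ 2 - c * real N)"
    using \<rho>N gN cN R2 t0 Q_range rho_pos g_nonneg by (intro mult_mono) auto
  also have "\<dots> = \<rho> ^ N * real N * (g * (\<rho> ^ N * (1 - c * real N) * (Q / 2))) * (1 - 2 / R ^ 2 - c * real N)"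
    by (simp add: mult.assoc)
  also have "\<dots> \<le> u N x y" by (rule xy)
  also have "u N x y = two_prob p {0<..} {..0} t x y" by (simp add: u_def h0)
  finally show ?thesis using xy(1) n by (intro exI[of _ x] exI[of _ y]) (simp add: R_def)
qed

theorem theorem2:
  fixes p :: "int pmf"
  assumes irred: "irreducible_kernel p"
    and first_moment: "(\<lambda>x. \<bar>real_of_int x\<bar> * pmf p x) summable_on UNIV"
    and heavy: "\<exists>c::real. c < 2 \<and> \<not> ((\<lambda>x. \<bar>real_of_int x\<bar> powr c * pmf p x) summable_on UNIV)"
  shows "\<not> tight_family (vm_space p) (\<lambda>t w. real_of_int (rmost w t - lmost w t))"
proof
  assume tight: "tight_family (vm_space p) (\<lambda>t w. real_of_int (rmost w t - lmost w t))"
  obtain c where "c < 2" "\<not> ((\<lambda>x. \<bar>real_of_int x\<bar> powr c * pmf p x) summable_on UNIV)"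
    using heavy by blast
  from heavy_scale[OF this] obtain C where C: "1 \<le> C" and scale: "\<And>m. \<exists>n\<ge>m. 0 < n \<and> 0 < measure_pmf.prob p {z. n \<le> \<bar>z\<bar>} \<and>
    (\<Sum>z\<in>{- n<..<n}. real_of_int z ^ 2 * pmf p z) \<le> C * real_of_int n ^ 2 * measure_pmf.prob p {z. n \<le> \<bar>z\<bar>}"
    by blast
  define \<tau> where "\<tau> = 1 / (4096 * C)"
  have \<tau>: "0 < \<tau>" using C by (simp add: \<tau>_def)
  \<comment> \<open>Half of the lower bound \<open>\<tau> / 64\<close>, which is the same at every
    scale, gives a strict contradiction.\<close>
  from tight[unfolded tight_family_def, rule_format, of "\<tau> / 128"] \<tau>
  obtain K where K: "\<And>t. 0 \<le> t \<Longrightarrow>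
      measure (vm_space p) {w \<in> space (vm_space p). \<bar>real_of_int (rmost w t - lmost w t)\<bar> > K} \<le> \<tau> / 128"
    by auto
  obtain n where n: "max 64 (2 * \<lceil>K\<rceil> + 2) \<le> n" and Q: "0 < measure_pmf.prob p {z. n \<le> \<bar>z\<bar>}"
    and V: "(\<Sum>z\<in>{- n<..<n}. real_of_int z ^ 2 * pmf p z) \<le> C * real_of_int n ^ 2 * measure_pmf.prob p {z. n \<le> \<bar>z\<bar>}"
    using scale[of "max 64 (2 * \<lceil>K\<rceil> + 2)"] by blast
  define t where "t = \<tau> / measure_pmf.prob p {z. n \<le> \<bar>z\<bar>}"
  have t: "0 \<le> t" unfolding t_def using \<tau> Q by simp
  obtain x y where xy: "real_of_int n / 2 \<le> real_of_int (y - x)" "\<tau> / 64 \<le> two_prob p {0<..} {..0} t x y"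
    using crossing_probability[OF C \<tau>_def _ Q V t_def] n by auto
  have "K < real_of_int n / 2" using n by linarith
  then have "K < real_of_int (y - x)" using xy(1) by linarith
  from two_prob_le_interface[OF first_moment t this] K[OF t] xy(2) \<tau> show False by simp
qed

end
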